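(* There exist absolute constants $C,c>0$ such that the following holds. Let $n\ge2$, $0<q<1$ and $\pi\sim\mu_{n,q}$. (i) If $0<q<1-\frac2n$ then for every integer $L\ge2$, $$\mathbb{P}(\mathrm{LDS}(\pi)\ge L)\le n^8\begin{cases}\left(\frac{C}{(1-q)L^2}\right)^L & L\le \frac{3}{1-q},\\ (C(1-q))^L q^{\frac{L(L-1)}{2}} & L>\frac{3}{1-q}.\end{cases}$$ Moreover, if $0<q<\frac12$ then for every integer $L\ge 2$, $\mathbb{P}(\mathrm{LDS}(\pi)\ge L)\le nC^Lq^{\frac{L(L-1)}{2}}$. (ii) For integer $L$, $$\mathbb{P}(\mathrm{LDS}(\pi)\ge L)\ge 1-\left(1-\left(\frac{c}{(1-q)L^2}\right)^L\right)^{\lfloor n(1-q)/4\rfloor}\quad\text{if } \frac{C}{\sqrt{1-q}}\le L\le\frac{1}{1-q}\text{ and }\frac12\le q\le 1-\frac4n,$$ and $$\mathbb{P}(\mathrm{LDS}(\pi)\ge L)\ge 1-\left(1-q^{\frac{L(L-1)}{2}}(1-q)^L\right)^{\lfloor n/L\rfloor}\quad\text{for any } L\ge 2.$$ (iii) Let $\frac12\le q\le 1-\frac4n$. For every integer $2\le L<\frac{c}{\sqrt{1-q}}$, $$\mathbb{P}(\mathrm{LDS}(\pi)<L)\le (C(1-q)L^2)^{n/L}.$$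
   Context: For $q>0$ and an integer $n\ge1$, the Mallows measure $\mu_{n,q}$ on $S_n$ is $\mu_{n,q}(\pi)=q^{\mathrm{inv}(\pi)}/Z_{n,q}$, where $\mathrm{inv}(\pi)$ is the number of pairs $i<j$ with $\pi(i)>\pi(j)$ and $Z_{n,q}$ is the normalizing constant. $\mathrm{LDS}(\pi)$ denotes the length of a longest decreasing subsequence of $\pi$, i.e. the maximal $m$ with indices $i_1<\dots<i_m$ such that $\pi(i_1)>\dots>\pi(i_m)$. *)

theory Defs
  imports "HOL-Analysis.Analysis" "HOL-Combinatorics.Permutations"
begin

definition perms :: "nat \<Rightarrow> (nat \<Rightarrow> nat) set" where
  "perms n = {p. p permutes {1..n}}"

definition inv_count :: "nat \<Rightarrow> (nat \<Rightarrow> nat) \<Rightarrow> nat" where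
  "inv_count n p = card {(i, j). i \<in> {1..n} \<and> j \<in> {1..n} \<and> i < j \<and> p i > p j}"

text \<open>Decreasing subsequences, identified with their index sets.\<close>
definition decr_set :: "nat \<Rightarrow> (nat \<Rightarrow> nat) \<Rightarrow> nat set \<Rightarrow> bool" where
  "decr_set n p S \<longleftrightarrow> S \<subseteq> {1..n} \<and> (\<forall>i\<in>S. \<forall>j\<in>S. i < j \<longrightarrow> p i > p j)"

definition LDS :: "nat \<Rightarrow> (nat \<Rightarrow> nat) \<Rightarrow> nat" where
  "LDS n p = Max {card S | S. decr_set n p S}"

definition mallows_Z :: "nat \<Rightarrow> real \<Rightarrow> real" where
  "mallows_Z n q = (\<Sum>p\<in>perms n. q ^ inv_count n p)"

definition mallows_prob :: "nat \<Rightarrow> real \<Rightarrow> ((nat \<Rightarrow> nat) \<Rightarrow> bool) \<Rightarrow> real" where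
  "mallows_prob n q E = (\<Sum>p\<in>{p \<in> perms n. E p}. q ^ inv_count n p) / mallows_Z n q"

end

theory Submission
  imports Defs
begin

text \<open>
  Under the Mallows measure the inversion code \<open>d\<^sub>j = #{i < j. \<pi>(i) > \<pi>(j)}\<close> has independent,
  truncated geometric entries, and whether an entry extends a decreasing subsequence depends only on
  the rank \<open>r\<close> of its last element: the entry \<open>d\<close> lies below it iff \<open>d \<ge> r\<close>, and otherwise raises
  \<open>r\<close> by one.

  Upper tail: the expected number of decreasing subsequences of length \<open>L\<close> solves a linear recursion
  in \<open>r\<close>, and is dominated by supersolutions. The supersolution \<open>A\<^sub>k q\<^bsup>kr\<^esup>\<close> settles \<open>L > 3/(1-q)\<close>
  and \<open>q < 1/2\<close>; for smaller \<open>L\<close> one takes differences of \<open>h(r) = exp(\<mu> \<Sum>\<^bsub>t>r\<^esub> \<surd>w(t))\<close> with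
  \<open>w(t) = (1-q)q\<^sup>t/(1-q\<^sup>t)\<close> and \<open>\<mu> = L\<surd>(1-q)\<close>, the WKB solution of \<open>h'' = \<mu>\<^sup>2 w h\<close>.

  Lower tail: disjoint blocks of the code are independent. In a block of length \<open>L\<close> the code
  \<open>0, 1, \<dots>, L-1\<close> is decreasing; in a block of length \<open>4/(1-q)\<close> a greedy extension succeeds in each
  of about \<open>1/(1-q)\<close> steps with probability of order \<open>1/L\<close>, by accepting only the next
  \<open>1/((1-q)L)\<close> ranks.

  Small values: a permutation with \<open>LDS < L\<close> is determined by an \<open>L\<close>-colouring of its positions and
  of its values, so there are at most \<open>L\<^bsup>2n\<^esup>\<close> of them, each of probability at most \<open>1/Z\<close>.
\<close>

section \<open>Inversion codes\<close>

definition inv_code :: "(nat \<Rightarrow> nat) \<Rightarrow> nat \<Rightarrow> nat" where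
  "inv_code p j = card {i \<in> {1..<j}. p i > p j}"

definition inv_codes :: "nat \<Rightarrow> (nat \<Rightarrow> nat) \<Rightarrow> nat list" where
  "inv_codes n p = map (inv_code p) [1..<Suc n]"

text \<open>The offset \<open>s\<close> is the number of positions already read, so tails and blocks
  of a code are again of this form.\<close>

definition code_lists :: "nat \<Rightarrow> nat \<Rightarrow> nat list set" where
  "code_lists s m = {ds. length ds = m \<and> (\<forall>i<m. ds ! i \<le> s + i)}"

text \<open>Expectation over \<open>m\<close> independent codes at positions \<open>s + 1, \<dots>, s + m\<close>, each a geometric
  variable truncated to the number of preceding positions.\<close>

primrec code_exp :: "real \<Rightarrow> nat \<Rightarrow> nat \<Rightarrow> (nat list \<Rightarrow> real) \<Rightarrow> real" where
  "code_exp q s 0 f = f []"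
| "code_exp q s (Suc m) f =
     (\<Sum>d\<le>s. q ^ d / (\<Sum>e\<le>s. q ^ e) * code_exp q (Suc s) m (\<lambda>ds. f (d # ds)))"

lemma code_lists_0: "code_lists s 0 = {[]}"
  by (auto simp: code_lists_def)

lemma code_lists_Suc:
  "code_lists s (Suc m) = (\<lambda>(d, ds). d # ds) ` ({..s} \<times> code_lists (Suc s) m)"
proof (intro equalityI subsetI)
  fix xs assume xs: "xs \<in> code_lists s (Suc m)"
  then obtain d ds where "xs = d # ds" by (cases xs) (auto simp: code_lists_def)
  moreover have "d \<le> s" using xs \<open>xs = d # ds\<close> by (auto simp: code_lists_def)
  moreover have "ds \<in> code_lists (Suc s) m"
    using xs \<open>xs = d # ds\<close> by (auto simp: code_lists_def)
  ultimately show "xs \<in> (\<lambda>(d, ds). d # ds) ` ({..s} \<times> code_lists (Suc s) m)" by auto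
next
  fix xs assume "xs \<in> (\<lambda>(d, ds). d # ds) ` ({..s} \<times> code_lists (Suc s) m)"
  then show "xs \<in> code_lists s (Suc m)"
    by (auto simp: code_lists_def nth_Cons split: nat.split)
qed

lemma sum_powers_pos: "0 < (\<Sum>e\<le>s. q ^ e)" if "0 < (q::real)"
  using that by (intro sum_pos) auto

text \<open>The weight is a product over positions, so peeling off the first entry pulls out its
  normaliser. This links the expectation \<open>code_exp\<close> to unnormalised Mallows
  weights.\<close>

lemma code_lists_sum:
  assumes "0 < q"
  shows "finite (code_lists s m) \<and> (\<Sum>ds\<in>code_lists s m. q ^ sum_list ds * f ds) =
    (\<Prod>i<m. \<Sum>e\<le>s + i. q ^ e) * code_exp q s m f"
proof (induction m arbitrary: s f)
  case 0
  then show ?case by (simp add: code_lists_0)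
next
  case (Suc m)
  have inj: "inj_on (\<lambda>(d, ds). d # ds) ({..s} \<times> code_lists (Suc s) m)"
    by (auto simp: inj_on_def)
  have "(\<Sum>ds\<in>code_lists s (Suc m). q ^ sum_list ds * f ds) =
      (\<Sum>(d, ds)\<in>{..s} \<times> code_lists (Suc s) m. q ^ (d + sum_list ds) * f (d # ds))"
    unfolding code_lists_Suc sum.reindex[OF inj] by (auto intro!: sum.cong)
  also have "\<dots> = (\<Sum>d\<le>s. q ^ d * (\<Sum>ds\<in>code_lists (Suc s) m. q ^ sum_list ds * f (d # ds)))"
    by (simp add: sum.cartesian_product[symmetric] sum_distrib_left power_add mult.assoc)
  also have "\<dots> = (\<Sum>d\<le>s. q ^ d *
      ((\<Prod>i<m. \<Sum>e\<le>Suc s + i. q ^ e) * code_exp q (Suc s) m (\<lambda>ds. f (d # ds))))"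
    using Suc.IH by simp
  also have "\<dots> = (\<Prod>i<Suc m. \<Sum>e\<le>s + i. q ^ e) * code_exp q s (Suc m) f"
    using sum_powers_pos[OF assms, of s]
    by (subst prod.lessThan_Suc_shift) (simp add: sum_distrib_left mult_ac)
  finally show ?case using Suc.IH by (auto simp: code_lists_Suc)
qed

lemma code_exp_mono:
  assumes "0 < q" and "\<And>ds. f ds \<le> g ds"
  shows "code_exp q s m f \<le> code_exp q s m g"
  using assms(2)
proof (induction m arbitrary: s f g)
  case (Suc m)
  have "0 \<le> q ^ d / (\<Sum>e\<le>s. q ^ e)" for d
    using assms(1) sum_powers_pos[OF assms(1), of s] by simp
  then show ?case
    unfolding code_exp.simps by (intro sum_mono mult_left_mono Suc.IH Suc.prems)
qed simp

lemma code_weights_sum: "0 < (q::real) \<Longrightarrow> (\<Sum>d\<le>s. q ^ d / (\<Sum>e\<le>s. q ^ e)) = 1"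
  using sum_powers_pos[of q s] by (simp add: sum_divide_distrib[symmetric])

lemma code_exp_const: "0 < q \<Longrightarrow> code_exp q s m (\<lambda>_. c) = c"
  by (induction m arbitrary: s)
     (simp_all only: code_exp.simps sum_distrib_right[symmetric] code_weights_sum mult_1)

lemma code_exp_add: "code_exp q s m (\<lambda>ds. f ds + g ds) = code_exp q s m f + code_exp q s m g"
  by (induction m arbitrary: s f g) (simp_all add: sum.distrib distrib_left)

lemma code_exp_diff: "code_exp q s m (\<lambda>ds. f ds - g ds) = code_exp q s m f - code_exp q s m g"
  by (induction m arbitrary: s f g) (simp_all add: sum_subtractf right_diff_distrib)

lemma code_exp_cmult: "code_exp q s m (\<lambda>ds. c * f ds) = c * code_exp q s m f"
  by (induction m arbitrary: s f) (simp_all add: sum_distrib_left mult_ac)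

text \<open>Independence of consecutive blocks: all the second block knows of the first is that
  \<open>a\<close> more positions have been read.\<close>

lemma code_exp_split:
  "code_exp q s (a + b) (\<lambda>ds. f (take a ds) * g (drop a ds)) =
    code_exp q s a f * code_exp q (s + a) b g"
proof (induction a arbitrary: s f)
  case 0
  then show ?case by (simp add: code_exp_cmult)
next
  case (Suc a)
  have "code_exp q (Suc s) (a + b) (\<lambda>ds. f (d # take a ds) * g (drop a ds)) =
      code_exp q (Suc s) a (\<lambda>ds. f (d # ds)) * code_exp q (Suc s + a) b g" for d
    by (rule Suc.IH)
  then show ?case by (simp add: sum_distrib_right mult.assoc)
qed

text \<open>At q = 1 the weighted sum in \<open>code_lists_sum\<close> is a plain count, the product
  of the sides of the box.\<close>

lemma card_code_lists: "card (code_lists 0 n) = fact n"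
proof -
  have "real (card (code_lists 0 n)) = (\<Prod>i<n. \<Sum>e\<le>i. 1)"
    using code_lists_sum[of 1 0 n "\<lambda>_. 1"] by (simp add: code_exp_const)
  also have "\<dots> = fact n"
    by (induction n) (simp_all add: mult_ac add_ac)
  finally show ?thesis by (metis of_nat_eq_iff of_nat_fact)
qed

section \<open>Correspondence between permutations and codes\<close>

text \<open>Here \<open>v\<close> is the value chosen last, or a sentinel above all values before
  any choice. If the new value is below \<open>v\<close>, its code counts every earlier value that
  is at least \<open>v\<close>. Otherwise \<open>v\<close> is itself an earlier value, and the code
  misses it, so the code is strictly smaller than the rank.\<close>

lemma inv_code_ge_iff:
  assumes inj: "inj_on p {1..n}" and t: "Suc t \<le> n"
    and v: "v \<in> p ` {1..t} \<or> (\<forall>i\<in>{1..n}. p i < v)"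
  shows "card {i \<in> {1..t}. p i \<ge> v} \<le> inv_code p (Suc t) \<longleftrightarrow> p (Suc t) < v"
proof
  assume "p (Suc t) < v"
  then show "card {i \<in> {1..t}. p i \<ge> v} \<le> inv_code p (Suc t)"
    unfolding inv_code_def by (intro card_mono) auto
next
  assume le: "card {i \<in> {1..t}. p i \<ge> v} \<le> inv_code p (Suc t)"
  show "p (Suc t) < v"
  proof (rule ccontr)
    assume n: "\<not> p (Suc t) < v"
    then obtain i where i: "i \<in> {1..t}" "v = p i" using v t by auto
    then have "{j \<in> {1..<Suc t}. p j > p (Suc t)} \<subset> {j \<in> {1..t}. p j \<ge> v}"
      using n by auto
    then have "inv_code p (Suc t) < card {i \<in> {1..t}. p i \<ge> v}"
      unfolding inv_code_def by (intro psubset_card_mono) auto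
    with le show False by simp
  qed
qed

lemma inv_codes_in: "inv_codes n p \<in> code_lists 0 n"
proof -
  have "inv_code p (Suc i) \<le> card {1..<Suc i}" for i
    unfolding inv_code_def by (intro card_mono) auto
  then show ?thesis by (auto simp: code_lists_def inv_codes_def simp del: upt_Suc)
qed

lemma sum_inv_codes: "sum_list (inv_codes n p) = inv_count n p"
proof -
  have "{(i, j). i \<in> {1..n} \<and> j \<in> {1..n} \<and> i < j \<and> p i > p j} =
      prod.swap ` (SIGMA j:{1..n}. {i \<in> {1..<j}. p i > p j})"
    by (auto simp: image_iff)
  then have "inv_count n p = card (SIGMA j:{1..n}. {i \<in> {1..<j}. p i > p j})"
    by (simp add: inv_count_def card_image)
  also have "\<dots> = (\<Sum>j\<in>{1..n}. inv_code p j)"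
    by (subst card_SigmaI) (auto simp: inv_code_def)
  also have "\<dots> = sum_list (inv_codes n p)"
    by (simp add: inv_codes_def interv_sum_list_conv_sum_set_nat atLeastLessThanSuc_atLeastAtMost del: upt_Suc)
  finally show ?thesis ..
qed

lemma permutes_value_eq_card:
  assumes "p permutes {1..n}" "i \<in> {1..n}"
  shows "p i = card {j \<in> {1..n}. p j \<le> p i}"
proof -
  have "p ` {j \<in> {1..n}. p j \<le> p i} = {1..p i}"
  proof (intro equalityI subsetI)
    fix v assume v: "v \<in> {1..p i}"
    moreover have "p i \<in> {1..n}" using assms(2) permutes_in_image[OF assms(1), of i] by blast
    ultimately have "v \<in> p ` {1..n}" using assms(1) by (simp add: permutes_image)
    then show "v \<in> p ` {j \<in> {1..n}. p j \<le> p i}" using v by auto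
  next
    fix v assume "v \<in> p ` {j \<in> {1..n}. p j \<le> p i}"
    then obtain j where "j \<in> {1..n}" "v = p j" "p j \<le> p i" by blast
    moreover then have "p j \<in> {1..n}" using permutes_in_image[OF assms(1), of j] by blast
    ultimately show "v \<in> {1..p i}" by simp
  qed
  moreover have "inj_on p {j \<in> {1..n}. p j \<le> p i}"
    using assms(1) by (meson permutes_inj_on)
  ultimately show ?thesis by (metis card_image card_atLeastAtMost diff_Suc_1)
qed

text \<open>By induction on \<open>t\<close>, the code fixes the relative order of the first
  \<open>t\<close> entries, since \<open>inv_code_ge_iff\<close> tells where the next entry is
  inserted. At \<open>t = n\<close> the relative order gives the values.\<close>

lemma inj_on_inv_codes: "inj_on (inv_codes n) (perms n)"
proof (rule inj_onI)
  fix p p' assume "p \<in> perms n" "p' \<in> perms n" and eq: "inv_codes n p = inv_codes n p'"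
  then have p: "p permutes {1..n}" and p': "p' permutes {1..n}" by (auto simp: perms_def)
  have code: "inv_code p j = inv_code p' j" if "j \<in> {1..n}" for j
    using eq that by (auto simp: inv_codes_def simp del: upt_Suc)
  have order: "\<forall>i\<in>{1..t}. \<forall>j\<in>{1..t}. p i \<le> p j \<longleftrightarrow> p' i \<le> p' j" if "t \<le> n" for t
    using that
  proof (induction t)
    case (Suc t)
    note IH = Suc.IH[OF Suc_leD[OF Suc.prems]]
    have less: "p (Suc t) < p i \<longleftrightarrow> p' (Suc t) < p' i" if i: "i \<in> {1..t}" for i
    proof -
      have "p (Suc t) < p i \<longleftrightarrow> card {j \<in> {1..t}. p j \<ge> p i} \<le> inv_code p (Suc t)"
        using i p Suc.prems by (subst inv_code_ge_iff) (auto intro: permutes_inj_on)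
      also have "{j \<in> {1..t}. p j \<ge> p i} = {j \<in> {1..t}. p' j \<ge> p' i}" using IH i by blast
      also have "inv_code p (Suc t) = inv_code p' (Suc t)" using code Suc.prems by simp
      also have "card {j \<in> {1..t}. p' j \<ge> p' i} \<le> inv_code p' (Suc t) \<longleftrightarrow> p' (Suc t) < p' i"
        using i p' Suc.prems by (subst inv_code_ge_iff) (auto intro: permutes_inj_on)
      finally show ?thesis .
    qed
    have ne: "p (Suc t) \<noteq> p i" "p' (Suc t) \<noteq> p' i" if "i \<in> {1..t}" for i
      using that inj_eq[OF permutes_inj[OF p]] inj_eq[OF permutes_inj[OF p']] by auto
    show ?case
    proof (intro ballI)
      fix i j assume ij: "i \<in> {1..Suc t}" "j \<in> {1..Suc t}"
      consider "i \<in> {1..t}" "j \<in> {1..t}" | "i = Suc t" "j \<in> {1..t}" | "i \<in> {1..t}" "j = Suc t"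
        | "i = Suc t" "j = Suc t" using ij by fastforce
      then show "p i \<le> p j \<longleftrightarrow> p' i \<le> p' j"
      proof cases
        case 1 then show ?thesis using IH by blast
      next
        case 2 then show ?thesis using less[of j] ne[of j] by auto
      next
        case 3 then show ?thesis using less[of i] by (auto simp: not_less[symmetric])
      qed auto
    qed
  qed simp
  show "p = p'"
  proof
    fix i show "p i = p' i"
    proof (cases "i \<in> {1..n}")
      case True
      have "{j \<in> {1..n}. p j \<le> p i} = {j \<in> {1..n}. p' j \<le> p' i}" using order[of n] True by blast
      then show ?thesis using permutes_value_eq_card[OF p True] permutes_value_eq_card[OF p' True] by simp
    next
      case False then show ?thesis using p p' by (simp add: permutes_not_in)
    qed
  qed
qed

lemma card_perms: "card (perms n) = fact n" "finite (perms n)"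
  unfolding perms_def by (auto simp: card_permutations finite_permutations)

text \<open>Surjectivity comes from counting: both sides have n! elements.\<close>

lemma bij_betw_inv_codes: "bij_betw (inv_codes n) (perms n) (code_lists 0 n)"
proof -
  have "inv_codes n ` perms n \<subseteq> code_lists 0 n" using inv_codes_in by auto
  moreover have "card (inv_codes n ` perms n) = card (code_lists 0 n)"
    using card_image[OF inj_on_inv_codes] by (simp add: card_perms card_code_lists)
  moreover have "finite (code_lists 0 n)" using code_lists_sum[of 1] by simp
  ultimately have "inv_codes n ` perms n = code_lists 0 n" by (simp add: card_subset_eq)
  then show ?thesis using inj_on_inv_codes by (simp add: bij_betw_def)
qed

text \<open>The bijection turns the inversion number into the sum of the code. Taking
  \<open>f\<close> constant 1 identifies the normaliser as the q-factorial.\<close>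

lemma sum_perms_code_exp:
  assumes "0 < q"
  shows "(\<Sum>p\<in>perms n. q ^ inv_count n p * f (inv_codes n p)) =
    (\<Prod>i<n. \<Sum>e\<le>i. q ^ e) * code_exp q 0 n f"
proof -
  have "(\<Sum>p\<in>perms n. q ^ inv_count n p * f (inv_codes n p)) =
      (\<Sum>p\<in>perms n. q ^ sum_list (inv_codes n p) * f (inv_codes n p))"
    by (simp add: sum_inv_codes)
  also have "\<dots> = (\<Sum>ds\<in>code_lists 0 n. q ^ sum_list ds * f ds)"
    by (rule sum.reindex_bij_betw[OF bij_betw_inv_codes])
  finally show ?thesis using code_lists_sum[OF assms, of 0 n f] by simp
qed

lemma mallows_Z_eq: "0 < q \<Longrightarrow> mallows_Z n q = (\<Prod>i<n. \<Sum>e\<le>i. q ^ e)"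
  using sum_perms_code_exp[of q n "\<lambda>_. 1"] by (simp add: mallows_Z_def code_exp_const)

lemma mallows_Z_pos: "0 < q \<Longrightarrow> 0 < mallows_Z n q"
  by (auto simp: mallows_Z_eq intro!: prod_pos sum_powers_pos)

lemma mallows_prob_code_exp:
  assumes "0 < q" and "\<And>p. p \<in> perms n \<Longrightarrow> E p \<longleftrightarrow> Q (inv_codes n p)"
  shows "mallows_prob n q E = code_exp q 0 n (\<lambda>ds. of_bool (Q ds))"
proof -
  have "(\<Sum>p\<in>{p \<in> perms n. E p}. q ^ inv_count n p) =
      (\<Sum>p\<in>perms n. q ^ inv_count n p * of_bool (Q (inv_codes n p)))"
    using assms(2) by (intro sum.mono_neutral_cong_left) (auto simp: card_perms)
  then have "mallows_prob n q E = mallows_Z n q * code_exp q 0 n (\<lambda>ds. of_bool (Q ds)) / mallows_Z n q"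
    using sum_perms_code_exp[OF assms(1), of n "\<lambda>ds. of_bool (Q ds)"]
    by (simp only: mallows_prob_def mallows_Z_eq[OF assms(1)])
  then show ?thesis using mallows_Z_pos[OF assms(1), of n] by simp
qed

section \<open>Decreasing subsequences read off the code\<close>

text \<open>\<open>dec_chains r k ds\<close> counts the ways to extend a decreasing sequence by \<open>k\<close> entries taken
  from the code \<open>ds\<close> of the remaining positions, where \<open>r\<close> is the rank from the top of its last
  entry among the entries seen so far (\<open>r = 0\<close> for the empty sequence). A new entry with code
  \<open>d\<close> lies above the last entry iff \<open>d < r\<close>, and has rank \<open>d + 1\<close>.\<close>

fun dec_chains :: "nat \<Rightarrow> nat \<Rightarrow> nat list \<Rightarrow> nat" where
  "dec_chains r 0 ds = 1"
| "dec_chains r (Suc k) [] = 0"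
| "dec_chains r (Suc k) (d # ds) =
     (if d < r then dec_chains (Suc r) (Suc k) ds
      else dec_chains r (Suc k) ds + dec_chains (Suc d) k ds)"

text \<open>Induction on the number of unread positions. A value above the threshold
  \<open>v\<close> only raises the rank; one below it may be skipped or become the new threshold.
  Only positivity is claimed, which is enough for \<open>LDS\<close>.\<close>

lemma dec_chains_pos_iff:
  assumes inj: "inj_on p {1..n}" and "t \<le> n"
    and "v \<in> p ` {1..t} \<or> (\<forall>i\<in>{1..n}. p i < v)"
  shows "dec_chains (card {i \<in> {1..t}. p i \<ge> v}) k (map (inv_code p) [Suc t..<Suc n]) > 0 \<longleftrightarrow>
    (\<exists>S. S \<subseteq> {Suc t..n} \<and> decr_set n p S \<and> card S = k \<and> (\<forall>j\<in>S. p j < v))"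
    (is "_ \<longleftrightarrow> (\<exists>S. ?P t v k S)")
  using assms(2-)
proof (induction "n - t" arbitrary: t v k)
  case 0
  then have "t = n" by simp
  then have "?P t v k S \<longleftrightarrow> S = {} \<and> k = 0" for S by (auto simp: decr_set_def)
  then show ?case using \<open>t = n\<close> by (cases k) auto
next
  case (Suc l)
  then have t: "Suc t \<le> n" and l: "l = n - Suc t" by auto
  show ?case
  proof (cases k)
    case 0
    have "?P t v 0 {}" by (auto simp: decr_set_def)
    then show ?thesis using 0 by (auto simp del: upt_Suc)
  next
    case (Suc k')
    let ?ds = "map (inv_code p) [Suc (Suc t)..<Suc n]"
    let ?r = "card {i \<in> {1..t}. p i \<ge> v}"
    have upt: "map (inv_code p) [Suc t..<Suc n] = inv_code p (Suc t) # ?ds"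
      using t by (subst upt_conv_Cons) auto
    have d_iff: "?r \<le> inv_code p (Suc t) \<longleftrightarrow> p (Suc t) < v"
      using inv_code_ge_iff[OF inj t] Suc.prems by blast
    have set_Suc: "{i \<in> {1..Suc t}. Q i} = {i \<in> {1..t}. Q i} \<union> (if Q (Suc t) then {Suc t} else {})"
      for Q by (auto simp: le_Suc_eq)
    have hyp: "v \<in> p ` {1..Suc t} \<or> (\<forall>i\<in>{1..n}. p i < v)" using Suc.prems by auto
    have interval: "{Suc t..n} = insert (Suc t) {Suc (Suc t)..n}" using t by auto
    have keep: "?P (Suc t) v k S \<Longrightarrow> ?P t v k S" for S unfolding interval by blast
    show ?thesis
    proof (cases "p (Suc t) < v")
      case False
      have "card {i \<in> {1..Suc t}. p i \<ge> v} = Suc ?r"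
        unfolding set_Suc using False by simp
      then have "dec_chains (Suc ?r) k ?ds > 0 \<longleftrightarrow> (\<exists>S. ?P (Suc t) v k S)"
        using Suc.hyps(1)[OF l t hyp, of k] by simp
      also have "\<dots> \<longleftrightarrow> (\<exists>S. ?P t v k S)"
      proof -
        have sub: "S \<subseteq> {Suc (Suc t)..n} \<longleftrightarrow> S \<subseteq> {Suc t..n}" if "\<forall>j\<in>S. p j < v" for S
          using that False unfolding interval by blast
        have "?P (Suc t) v k S \<longleftrightarrow> ?P t v k S" for S using sub[of S] by meson
        then show ?thesis by (simp only:)
      qed
      finally show ?thesis using False d_iff unfolding upt \<open>k = Suc k'\<close> by (simp del: upt_Suc)
    next
      case True
      let ?v = "p (Suc t)"
      have r1: "card {i \<in> {1..Suc t}. p i \<ge> v} = ?r"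
        unfolding set_Suc using True by simp
      \<comment> \<open>Earlier values differ from the new one, so weak and strict comparison agree
        on them. The new entry itself then adds one, whence the rank \<open>d + 1\<close> in
        \<open>dec_chains\<close>.\<close>
      have "{i \<in> {1..t}. p i \<ge> ?v} = {i \<in> {1..<Suc t}. p i > ?v}"
      proof -
        have "?v \<le> p i \<longleftrightarrow> ?v < p i" if "i \<in> {1..t}" for i
          using that t inj_onD[OF inj, of i "Suc t"] by (auto simp: le_less)
        then show ?thesis unfolding atLeastLessThanSuc_atLeastAtMost
          by (intro Collect_cong) blast
      qed
      then have r2: "card {i \<in> {1..Suc t}. p i \<ge> ?v} = Suc (inv_code p (Suc t))"
        unfolding set_Suc inv_code_def by simp
      have c1: "dec_chains ?r k ?ds > 0 \<longleftrightarrow> (\<exists>S. ?P (Suc t) v k S)"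
        using Suc.hyps(1)[OF l t hyp, of k] r1 by simp
      have c2: "dec_chains (Suc (inv_code p (Suc t))) k' ?ds > 0 \<longleftrightarrow> (\<exists>S. ?P (Suc t) ?v k' S)"
        using Suc.hyps(1)[OF l t, of ?v k'] r2 by simp
      \<comment> \<open>Split on whether position \<open>Suc t\<close> belongs to the
        subsequence.\<close>
      have "(\<exists>S. ?P t v k S) \<longleftrightarrow> (\<exists>S. ?P (Suc t) v k S) \<or> (\<exists>S. ?P (Suc t) ?v k' S)"
      proof (rule iffI)
        assume "\<exists>S. ?P t v k S"
        then obtain S where S: "?P t v k S" by blast
        show "(\<exists>S. ?P (Suc t) v k S) \<or> (\<exists>S. ?P (Suc t) ?v k' S)"
        proof (cases "Suc t \<in> S")
          case True
          have fin: "finite S" using S by (meson finite_atLeastAtMost finite_subset)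
          have sub: "S - {Suc t} \<subseteq> {Suc (Suc t)..n}" using S unfolding interval by blast
          moreover have "card (S - {Suc t}) = k'" using S True fin \<open>k = Suc k'\<close> by simp
          moreover have "decr_set n p (S - {Suc t})" using S unfolding decr_set_def by blast
          moreover have "p j < ?v" if "j \<in> S - {Suc t}" for j
          proof -
            have "Suc t < j" using that sub by auto
            then show ?thesis using S True that unfolding decr_set_def by blast
          qed
          ultimately show ?thesis by blast
        next
          case False
          then have "?P (Suc t) v k S"
            using S unfolding interval by blast
          then show ?thesis by blast
        qed
      next
        have take: "\<exists>S. ?P t v k S" if "\<exists>S. ?P (Suc t) ?v k' S"
        proof -
          from that obtain S where S: "?P (Suc t) ?v k' S" by blast
          have fin: "finite S" "Suc t \<notin> S"
            using S by (meson finite_atLeastAtMost finite_subset) (use S in auto)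
          have "insert (Suc t) S \<subseteq> {Suc t..n}" using S unfolding interval by blast
          moreover have "card (insert (Suc t) S) = k" using fin \<open>k = Suc k'\<close> S by simp
          moreover have "decr_set n p (insert (Suc t) S)"
            unfolding decr_set_def
          proof (intro conjI ballI impI)
            show "insert (Suc t) S \<subseteq> {1..n}" using S t by auto
            fix i j assume "i \<in> insert (Suc t) S" "j \<in> insert (Suc t) S" "i < j"
            moreover have "Suc t < i" if "i \<in> S" for i using S that by auto
            ultimately show "p j < p i" using S unfolding decr_set_def
              by (metis insert_iff less_asym)
          qed
          moreover have "\<forall>j\<in>insert (Suc t) S. p j < v" using S True less_trans by blast
          ultimately show "\<exists>S. ?P t v k S" by blast
        qed
        assume "(\<exists>S. ?P (Suc t) v k S) \<or> (\<exists>S. ?P (Suc t) ?v k' S)"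
        then show "\<exists>S. ?P t v k S"
        proof
          assume "\<exists>S. ?P (Suc t) v k S"
          then obtain S where "?P (Suc t) v k S" ..
          from keep[OF this] show ?thesis ..
        qed (rule take)
      qed
      then show ?thesis using True d_iff c1 c2 unfolding upt \<open>k = Suc k'\<close>
        by (simp del: upt_Suc)
    qed
  qed
qed

lemma decr_sets_finite: "finite {card S | S. decr_set n p S}"
proof -
  have "{card S | S. decr_set n p S} \<subseteq> card ` Pow {1..n}" by (auto simp: decr_set_def)
  then show ?thesis by (rule finite_subset) simp
qed

lemma le_LDS_iff: "L \<le> LDS n p \<longleftrightarrow> (\<exists>S. decr_set n p S \<and> card S = L)"
proof
  assume "L \<le> LDS n p"
  moreover have "LDS n p \<in> {card S | S. decr_set n p S}"
    unfolding LDS_def by (rule Max_in[OF decr_sets_finite]) (auto simp: decr_set_def)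
  ultimately obtain S where "decr_set n p S" "L \<le> card S" by auto
  moreover then obtain T where "T \<subseteq> S" "card T = L" using obtain_subset_with_card_n by metis
  moreover then have "decr_set n p T" using \<open>decr_set n p S\<close> unfolding decr_set_def by blast
  ultimately show "\<exists>S. decr_set n p S \<and> card S = L" by blast
next
  assume "\<exists>S. decr_set n p S \<and> card S = L"
  then show "L \<le> LDS n p" unfolding LDS_def by (intro Max_ge[OF decr_sets_finite]) auto
qed

lemma le_LDS_iff_chains:
  assumes "p \<in> perms n"
  shows "L \<le> LDS n p \<longleftrightarrow> dec_chains 0 L (inv_codes n p) > 0"
proof -
  have p: "p permutes {1..n}" using assms by (simp add: perms_def)
  have lt: "p i < Suc n" if "i \<in> {1..n}" for i using permutes_in_image[OF p, of i] that by simp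
  then have "dec_chains 0 L (inv_codes n p) > 0 \<longleftrightarrow>
      (\<exists>S. S \<subseteq> {Suc 0..n} \<and> decr_set n p S \<and> card S = L \<and> (\<forall>j\<in>S. p j < Suc n))"
    using dec_chains_pos_iff[of p n 0 "Suc n" L] permutes_inj_on[OF p]
    by (simp add: inv_codes_def del: upt_Suc)
  also have "\<dots> \<longleftrightarrow> (\<exists>S. decr_set n p S \<and> card S = L)"
  proof -
    have "S \<subseteq> {Suc 0..n} \<and> (\<forall>j\<in>S. p j < Suc n)" if "decr_set n p S" for S
      using that lt unfolding decr_set_def by fastforce
    then have "S \<subseteq> {Suc 0..n} \<and> decr_set n p S \<and> card S = L \<and> (\<forall>j\<in>S. p j < Suc n) \<longleftrightarrow>
        decr_set n p S \<and> card S = L" for S by blast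
    then show ?thesis by (simp only:)
  qed
  finally show ?thesis by (simp add: le_LDS_iff)
qed

lemma mallows_prob_LDS_ge:
  "0 < q \<Longrightarrow> mallows_prob n q (\<lambda>p. LDS n p \<ge> L) = code_exp q 0 n (\<lambda>ds. of_bool (dec_chains 0 L ds > 0))"
  by (rule mallows_prob_code_exp) (auto simp: le_LDS_iff_chains)

section \<open>Supersolutions and the upper tail\<close>

lemma geom_sum_mult: "(1 - q) * (\<Sum>d<r. q ^ d) = 1 - (q::real) ^ r"
  by (simp add: one_diff_power_eq)

text \<open>Condition on the first code: \<open>step\<close> says exactly that \<open>H\<close>
  dominates the resulting recursion, after clearing the normaliser and multiplying by 1 - q. The sum
  \<open>r + k\<close> never decreases along the recursion: a skip keeps it, a larger value raises
  \<open>r\<close>, and a choice trades one unit of \<open>k\<close> for at least one of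
  \<open>r\<close>. Hence \<open>step\<close> is demanded only where
  \<open>K \<le> r + k\<close>.\<close>

lemma code_exp_dec_chains_le:
  assumes q: "0 < q" "q < 1"
    and H0: "\<And>r. 1 \<le> H 0 r" and nonneg: "\<And>k r. 1 \<le> r \<Longrightarrow> 0 \<le> H k r"
    and step: "\<And>k r M. k < K \<Longrightarrow> 1 \<le> r \<Longrightarrow> K \<le> r + k \<Longrightarrow> r \<le> M \<Longrightarrow> M < N \<Longrightarrow>
      (1 - q) * (\<Sum>d=r..M. q ^ d * H k (Suc d)) \<le> (1 - q ^ r) * (H (Suc k) r - H (Suc k) (Suc r))"
    and "k \<le> K" "1 \<le> r" "r \<le> s" "s + m \<le> N" "K < r + k"
  shows "code_exp q s m (\<lambda>ds. real (dec_chains r k ds)) \<le> H k r"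
  using assms(6-10)
proof (induction m arbitrary: s r k)
  case 0
  then show ?case using H0 nonneg by (cases k) auto
next
  case (Suc m)
  show ?case
  proof (cases k)
    case 0
    then show ?thesis using H0[of r] q by (simp only: dec_chains.simps of_nat_1 code_exp_const)
  next
    case (Suc k')
    let ?Z = "\<Sum>e\<le>s. q ^ e"
    have Z: "0 < ?Z" by (rule sum_powers_pos[OF q(1)])
    let ?E = "\<lambda>d. code_exp q (Suc s) m (\<lambda>ds. real (dec_chains r k (d # ds)))"
    have lt: "?E d \<le> H k (Suc r)" if "d < r" for d
    proof -
      have "?E d = code_exp q (Suc s) m (\<lambda>ds. real (dec_chains (Suc r) k ds))"
        using that Suc by simp
      also have "\<dots> \<le> H k (Suc r)" using Suc.prems by (intro Suc.IH) auto
      finally show ?thesis .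
    qed
    have ge: "?E d \<le> H k r + H k' (Suc d)" if "r \<le> d" "d \<le> s" for d
    proof -
      have "?E d = code_exp q (Suc s) m (\<lambda>ds. real (dec_chains r k ds))
          + code_exp q (Suc s) m (\<lambda>ds. real (dec_chains (Suc d) k' ds))"
        using that Suc by (simp add: code_exp_add)
      also have "\<dots> \<le> H k r + H k' (Suc d)"
        using Suc.prems that Suc by (intro add_mono Suc.IH) auto
      finally show ?thesis .
    qed
    have split: "(\<Sum>d\<le>s. f d) = (\<Sum>d<r. f d) + (\<Sum>d=r..s. f d)" for f :: "nat \<Rightarrow> real"
    proof -
      have "{..s} = {..<r} \<union> {r..s}" using Suc.prems by auto
      then show ?thesis by (simp only:) (rule sum.union_disjoint, auto)
    qed
    have "?Z * code_exp q s (Suc m) (\<lambda>ds. real (dec_chains r k ds)) = (\<Sum>d\<le>s. q ^ d * ?E d)"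
      using Z by (simp add: sum_distrib_left)
    also have "\<dots> \<le> (\<Sum>d<r. q ^ d * H k (Suc r)) + (\<Sum>d=r..s. q ^ d * (H k r + H k' (Suc d)))"
      unfolding split using lt ge q by (intro add_mono sum_mono mult_left_mono) auto
    also have "\<dots> = ?Z * H k r - (\<Sum>d<r. q ^ d) * (H k r - H k (Suc r))
        + (\<Sum>d=r..s. q ^ d * H k' (Suc d))"
      unfolding split by (simp add: sum.distrib sum_distrib_left sum_distrib_right algebra_simps)
    also have "\<dots> \<le> ?Z * H k r"
    proof -
      have "(1 - q) * (\<Sum>d=r..s. q ^ d * H k' (Suc d)) \<le> (1 - q ^ r) * (H k r - H k (Suc r))"
        using step[of k' r s] Suc.prems Suc by simp
      also have "\<dots> = (1 - q) * ((\<Sum>d<r. q ^ d) * (H k r - H k (Suc r)))"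
        by (simp only: geom_sum_mult[symmetric] mult.assoc)
      finally show ?thesis using q by simp
    qed
    finally show ?thesis using Z by simp
  qed
qed

text \<open>Rank 0 needs separate treatment, since the factor 1 - q^r in the supersolution condition
  vanishes there. The chain starts at one of the \<open>m\<close> positions, and each start costs at
  most \<open>B\<close>.\<close>

lemma code_exp_dec_chains_0_le:
  assumes q: "0 < q"
    and B: "\<And>s m r. 1 \<le> r \<Longrightarrow> r \<le> s \<Longrightarrow> s + m \<le> N \<Longrightarrow>
      code_exp q s m (\<lambda>ds. real (dec_chains r K ds)) \<le> B"
    and "s + m \<le> N"
  shows "code_exp q s m (\<lambda>ds. real (dec_chains 0 (Suc K) ds)) \<le> real m * B"
  using assms(3)
proof (induction m arbitrary: s)
  case (Suc m)
  have "code_exp q s (Suc m) (\<lambda>ds. real (dec_chains 0 (Suc K) ds)) \<le>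
      (\<Sum>d\<le>s. q ^ d / (\<Sum>e\<le>s. q ^ e) * (real m * B + B))"
    unfolding code_exp.simps
  proof (intro sum_mono mult_left_mono)
    fix d assume "d \<in> {..s}"
    then show "code_exp q (Suc s) m (\<lambda>ds. real (dec_chains 0 (Suc K) (d # ds))) \<le> real m * B + B"
      using Suc.IH[of "Suc s"] Suc.prems B[of "Suc d" "Suc s" m] by (simp add: code_exp_add)
    show "0 \<le> q ^ d / (\<Sum>e\<le>s. q ^ e)" using q sum_powers_pos[OF q, of s] by simp
  qed
  also have "\<dots> = real (Suc m) * B"
    by (simp only: sum_distrib_right[symmetric] code_weights_sum[OF q]) (simp add: algebra_simps)
  finally show ?case .
qed simp

text \<open>First moment method: the indicator of a chain is at most the number of chains.\<close>

lemma mallows_prob_LDS_le: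
  assumes q: "0 < q" "q < 1"
    and H0: "\<And>r. 1 \<le> H 0 r" and nonneg: "\<And>k r. 1 \<le> r \<Longrightarrow> 0 \<le> H k r"
    and step: "\<And>k r M. k < K \<Longrightarrow> 1 \<le> r \<Longrightarrow> K \<le> r + k \<Longrightarrow> r \<le> M \<Longrightarrow> M < n \<Longrightarrow>
      (1 - q) * (\<Sum>d=r..M. q ^ d * H k (Suc d)) \<le> (1 - q ^ r) * (H (Suc k) r - H (Suc k) (Suc r))"
    and B: "\<And>r. 1 \<le> r \<Longrightarrow> r \<le> n \<Longrightarrow> H K r \<le> B"
  shows "mallows_prob n q (\<lambda>p. LDS n p \<ge> Suc K) \<le> real n * B"
proof -
  have "mallows_prob n q (\<lambda>p. LDS n p \<ge> Suc K) \<le>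
      code_exp q 0 n (\<lambda>ds. real (dec_chains 0 (Suc K) ds))"
    unfolding mallows_prob_LDS_ge[OF q(1)] using q(1)
    by (intro code_exp_mono) (auto simp: of_bool_def)
  also have "\<dots> \<le> real n * B"
  proof (rule code_exp_dec_chains_0_le[OF q(1)])
    fix s m r :: nat assume *: "1 \<le> r" "r \<le> s" "s + m \<le> n"
    have "code_exp q s m (\<lambda>ds. real (dec_chains r K ds)) \<le> H K r"
      by (rule code_exp_dec_chains_le[where K = K and N = n, OF q H0 nonneg step])
        (use * in auto)
    also have "\<dots> \<le> B" using B * by simp
    finally show "code_exp q s m (\<lambda>ds. real (dec_chains r K ds)) \<le> B" .
  qed simp
  finally show ?thesis .
qed

section \<open>The product supersolution\<close>

lemma geom_tail_le:
  assumes "0 \<le> x" "x < (1::real)"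
  shows "(1 - x) * (\<Sum>d=r..M. x ^ d) \<le> x ^ r"
proof (cases "r \<le> M")
  case True
  have "(1 - x) * (\<Sum>d=r..M. x ^ d) = x ^ r - x ^ Suc M" using sum_gp_multiplied[OF True, of x] by simp
  then show ?thesis using assms by simp
qed (use assms in simp)

lemma mallows_prob_LDS_le_prod:
  assumes q: "0 < q" "q < 1"
  shows "mallows_prob n q (\<lambda>p. LDS n p \<ge> Suc K) \<le>
    real n * ((1 - q) ^ K * q ^ (Suc K * K div 2) / (\<Prod>j<K. 1 - q ^ Suc j) ^ 3)"
proof -
  \<comment> \<open>In each factor, one 1 - q^(j+1) pays for the geometric tail and one for the
    difference of consecutive powers. The factor 1 - q^(K-j) bounds 1 - q^r from below, because
    \<open>K \<le> r + k\<close> forces r to be at least K - j at level j.\<close>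
  define A where "A k = (\<Prod>j<k. (1 - q) * q ^ j / ((1 - q ^ Suc j)\<^sup>2 * (1 - q ^ (K - j))))" for k
  define H where "H k r = A k * q ^ (k * r)" for k r
  have pow: "0 < 1 - q ^ j" if "0 < j" for j using q that by (simp add: power_less_one_iff)
  have pow0: "0 \<le> 1 - q ^ j" for j using q by (simp add: power_le_one)
  have A0: "0 \<le> A k" for k
    unfolding A_def using q pow0 by (intro prod_nonneg) auto
  have "mallows_prob n q (\<lambda>p. LDS n p \<ge> Suc K) \<le> real n * (A K * q ^ K)"
  proof (rule mallows_prob_LDS_le[OF q, where H = H])
    show "1 \<le> H 0 r" for r by (simp add: H_def A_def)
    show "0 \<le> H k r" for k r using A0 q by (simp add: H_def)
    show "H K r \<le> A K * q ^ K" if "1 \<le> r" for r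
      unfolding H_def using A0 q that by (intro mult_left_mono power_decreasing) auto
  next
    fix k r M assume k: "k < K" and r: "1 \<le> r" "K \<le> r + k"
    let ?x = "q ^ Suc k"
    have x: "0 \<le> ?x" "?x < 1" using q pow[of "Suc k"] by auto
    have ASuc: "A (Suc k) = A k * ((1 - q) * q ^ k / ((1 - ?x)\<^sup>2 * (1 - q ^ (K - k))))"
      by (simp add: A_def)
    have summand: "q ^ d * H k (Suc d) = A k * q ^ k * ?x ^ d" for d
    proof -
      have "q ^ d * q ^ (k * Suc d) = q ^ k * ?x ^ d"
        by (simp only: power_add[symmetric] power_mult[symmetric]) (simp add: algebra_simps)
      then show ?thesis by (simp add: H_def mult_ac)
    qed
    have "(1 - q) * (\<Sum>d=r..M. q ^ d * H k (Suc d)) = (1 - q) * (A k * q ^ k) * (\<Sum>d=r..M. ?x ^ d)"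
      unfolding summand sum_distrib_left[symmetric] by simp
    also have "\<dots> \<le> (1 - q) * (A k * q ^ k) * (?x ^ r / (1 - ?x))"
      using geom_tail_le[OF x, of r M] x q A0
      by (intro mult_left_mono) (auto simp: pos_le_divide_eq mult.commute)
    also have "\<dots> = (1 - q ^ (K - k)) * A (Suc k) * (?x ^ r * (1 - ?x))"
      using x pow[of "K - k"] k unfolding ASuc by (simp add: power2_eq_square)
    also have "\<dots> \<le> (1 - q ^ r) * A (Suc k) * (?x ^ r * (1 - ?x))"
    proof -
      have "q ^ r \<le> q ^ (K - k)" using q r by (intro power_decreasing) auto
      then show ?thesis using A0 x by (intro mult_right_mono) auto
    qed
    also have "\<dots> = (1 - q ^ r) * (H (Suc k) r - H (Suc k) (Suc r))"
    proof -
      have e: "q ^ (Suc k * r) = ?x ^ r" "q ^ (Suc k * Suc r) = ?x ^ Suc r"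
        by (simp_all only: power_mult)
      show ?thesis unfolding H_def e by (simp add: algebra_simps)
    qed
    finally show "(1 - q) * (\<Sum>d=r..M. q ^ d * H k (Suc d)) \<le> (1 - q ^ r) * (H (Suc k) r - H (Suc k) (Suc r))" .
  qed
  \<comment> \<open>Reversing the index turns the product of 1 - q^(K-j) into a third copy of the
    other one, which explains the cube. The exponents 0, ..., K-1, together with K from r = 1, add
    up to K(K+1)/2.\<close>
  also have "A K * q ^ K = (1 - q) ^ K * q ^ (Suc K * K div 2) / (\<Prod>j<K. 1 - q ^ Suc j) ^ 3"
  proof -
    have "(\<Prod>j<K. 1 - q ^ (K - j)) = (\<Prod>j<K. 1 - q ^ Suc j)"
      by (subst prod.nat_diff_reindex[symmetric]) (auto intro!: prod.cong)
    moreover have "(\<Prod>j<K. q ^ j) * q ^ K = q ^ (Suc K * K div 2)"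
    proof -
      have "(\<Prod>j<K. q ^ j) * q ^ K = (\<Prod>j\<in>{..K}. q ^ j)" by (simp add: lessThan_Suc_atMost[symmetric])
      also have "\<dots> = q ^ (\<Sum>{0..K})" by (simp add: power_sum atLeast0AtMost)
      finally show ?thesis by (simp add: gauss_sum_nat mult.commute)
    qed
    ultimately show ?thesis
      unfolding A_def by (simp add: prod_dividef prod.distrib prod_power_distrib power3_eq_cube power2_eq_square mult.assoc)
  qed
  finally show ?thesis .
qed

section \<open>The exponential supersolution\<close>

text \<open>The right side is the square of 2 sinh(a/2), and 2 sinh(y) is at least 2y. It converts
  the exponential profile into a second difference bound.\<close>

lemma exp_add_exp_minus_ge:
  fixes a :: real assumes "0 \<le> a" shows "a\<^sup>2 \<le> exp a + exp (- a) - 2"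
proof -
  have square: "(exp (x / 2) - exp (- (x / 2)))\<^sup>2 = exp x + exp (- x) - 2" for x :: real
  proof -
    have "exp (x / 2) * exp (- (x / 2)) = 1" by (rule exp_minus_inverse)
    then show ?thesis by (simp add: power2_diff exp_double[symmetric])
  qed
  have sinh: "2 * y \<le> exp y - exp (- y)" if "0 \<le> y" for y :: real
  proof -
    have "(\<lambda>y. exp y - exp (- y) - 2 * y) 0 \<le> (\<lambda>y. exp y - exp (- y) - 2 * y) y"
    proof (rule DERIV_nonneg_imp_nondecreasing[OF that])
      fix x :: real
      have "((\<lambda>y. exp y - exp (- y) - 2 * y) has_real_derivative (exp x + exp (- x) - 2)) (at x)"
        by (auto intro!: derivative_eq_intros)
      moreover have "0 \<le> (exp (x / 2) - exp (- (x / 2)))\<^sup>2" by simp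
      then have "0 \<le> exp x + exp (- x) - 2" unfolding square .
      ultimately show "\<exists>y. ((\<lambda>y. exp y - exp (- y) - 2 * y) has_real_derivative y) (at x) \<and> 0 \<le> y" by blast
    qed
    then show ?thesis by simp
  qed
  have "a\<^sup>2 = (2 * (a / 2))\<^sup>2" by simp
  also have "\<dots> \<le> (exp (a / 2) - exp (- (a / 2)))\<^sup>2"
    using sinh[of "a / 2"] assms by (intro power_mono) auto
  also have "\<dots> = exp a + exp (- a) - 2" by (rule square)
  finally show ?thesis .
qed

text \<open>With \<open>H k\<close> a scaled first difference of \<open>h\<close>, the sum in the
  supersolution condition telescopes to at most \<open>h r\<close>. What remains is the discrete
  convexity \<open>h_convex\<close>, a difference version of h'' = mu^2 w h. Level 0 is the constant
  1 instead, and fits because h is at least 1.\<close>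

lemma mallows_prob_LDS_le_exp:
  fixes \<mu> :: real
  assumes q: "0 < q" "q < 1" and \<mu>: "0 < \<mu>" and K: "1 \<le> K"
  shows "mallows_prob n q (\<lambda>p. LDS n p \<ge> Suc K) \<le> real n *
    (exp (\<mu> * (\<Sum>t=1..n. sqrt ((1 - q) * q ^ t / (1 - q ^ t)))) / (\<mu> ^ (2 * K) * (1 - q)))"
proof -
  define w where "w t = (1 - q) * q ^ t / (1 - q ^ t)" for t
  define h where "h r = exp (\<mu> * (\<Sum>t\<in>{r<..n}. sqrt (w t)))" for r
  define H where "H k r = (if k = 0 then 1 else (h (r - 1) - h r) / (\<mu> ^ (2 * k) * (1 - q)))"
    for k r
  have pow: "0 < 1 - q ^ j" if "0 < j" for j using q that by (simp add: power_less_one_iff)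
  have pow0: "0 \<le> 1 - q ^ j" for j using q by (simp add: power_le_one)
  have w0: "0 \<le> w t" for t using q pow0 by (simp add: w_def)
  have h1: "1 \<le> h r" for r unfolding h_def using w0 \<mu> by (auto intro!: mult_nonneg_nonneg sum_nonneg)
  have h_rec: "h r = h (Suc r) * exp (\<mu> * sqrt (w (Suc r)))" if "r < n" for r
  proof -
    have "{r<..n} = insert (Suc r) {Suc r<..n}" using that by auto
    then have "(\<Sum>t\<in>{r<..n}. sqrt (w t)) = sqrt (w (Suc r)) + (\<Sum>t\<in>{Suc r<..n}. sqrt (w t))" by simp
    then show ?thesis by (simp add: h_def exp_add distrib_left mult.commute)
  qed
  have h_end: "h r = 1" if "n \<le> r" for r using that by (simp add: h_def)
  have h_anti: "h (Suc r) \<le> h r" for r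
  proof (cases "r < n")
    case True
    have "1 \<le> exp (\<mu> * sqrt (w (Suc r)))" using w0 \<mu> by simp
    then show ?thesis unfolding h_rec[OF True] using h1[of "Suc r"] by simp
  qed (use h_end in simp)
  have w_anti: "w (Suc t) \<le> w t" if "0 < t" for t
    unfolding w_def using q pow[of t] pow[of "Suc t"] that
    by (intro frac_le mult_left_mono) (auto intro!: mult_nonneg_nonneg simp: mult_le_cancel_right2)
  have h_convex: "\<mu>\<^sup>2 * w r * h r \<le> (h (r - 1) - h r) - (h r - h (Suc r))" if r: "1 \<le> r" "r \<le> n" for r
  proof -
    let ?a = "\<mu> * sqrt (w r)"
    have a: "0 \<le> ?a" using \<mu> w0 by simp
    have 1: "h (r - 1) = h r * exp ?a" using h_rec[of "r - 1"] r by simp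
    have 2: "h r * exp (- ?a) \<le> h (Suc r)"
    \<comment> \<open>Since \<open>w\<close> decreases, the next step of \<open>h\<close> is no
      steeper than the current one. At r = n the profile is already constant and the claim is
      trivial.\<close>
    proof (cases "r < n")
      case True
      have "h r * exp (- ?a) = h (Suc r) * exp (\<mu> * sqrt (w (Suc r)) - ?a)"
        unfolding h_rec[OF True] by (simp add: exp_diff exp_minus field_simps)
      also have "\<dots> \<le> h (Suc r) * 1"
        using w_anti[of r] r \<mu> h1[of "Suc r"] by (intro mult_left_mono) auto
      finally show ?thesis by simp
    next
      case False
      then show ?thesis using r h_end[of r] h_end[of "Suc r"] a by simp
    qed
    have "\<mu>\<^sup>2 * w r * h r = ?a\<^sup>2 * h r" using w0 by (simp add: power_mult_distrib)
    also have "\<dots> \<le> (exp ?a + exp (- ?a) - 2) * h r"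
      using exp_add_exp_minus_ge[OF a] h1[of r] by (intro mult_right_mono) auto
    also have "\<dots> \<le> (h (r - 1) - h r) - (h r - h (Suc r))"
      using 2 unfolding 1 by (simp add: algebra_simps)
    finally show ?thesis .
  qed
  have "mallows_prob n q (\<lambda>p. LDS n p \<ge> Suc K) \<le> real n * (h 0 / (\<mu> ^ (2 * K) * (1 - q)))"
  proof (rule mallows_prob_LDS_le[OF q, where H = H])
    show "1 \<le> H 0 r" for r by (simp add: H_def)
    show "0 \<le> H k r" if "1 \<le> r" for k r
      using h_anti[of "r - 1"] that q \<mu> by (simp add: H_def)
    show "H K r \<le> h 0 / (\<mu> ^ (2 * K) * (1 - q))" if "1 \<le> r" for r
    proof -
      have "h (r - 1) \<le> h 0" using lift_Suc_antimono_le[of h 0 "r - 1"] h_anti by simp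
      then show ?thesis using K q \<mu> h1[of r] by (simp add: H_def divide_right_mono)
    qed
  next
    fix k r M assume r: "1 \<le> r" "r \<le> M" "M < n"
    have "(1 - q) * (\<Sum>d=r..M. q ^ d * H k (Suc d)) \<le> q ^ r * h r / \<mu> ^ (2 * k)"
    proof (cases "k = 0")
      case True
      then have "(1 - q) * (\<Sum>d=r..M. q ^ d * H k (Suc d)) \<le> q ^ r"
        using geom_tail_le[of q r M] q by (simp add: H_def)
      also have "\<dots> \<le> q ^ r * h r" using q h1[of r] by simp
      finally show ?thesis using True by simp
    next
      case False
      have "(1 - q) * (\<Sum>d=r..M. q ^ d * H k (Suc d)) = (\<Sum>d=r..M. q ^ d * ((h d - h (Suc d)) / \<mu> ^ (2 * k)))"
        using q False by (simp add: H_def sum_distrib_left)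
      also have "\<dots> \<le> (\<Sum>d=r..M. q ^ r * ((h d - h (Suc d)) / \<mu> ^ (2 * k)))"
        using h_anti q \<mu> by (intro sum_mono mult_right_mono power_decreasing) auto
      also have "\<dots> = q ^ r / \<mu> ^ (2 * k) * (\<Sum>d=r..M. h d - h (Suc d))"
        by (simp add: sum_distrib_left)
      also have "(\<Sum>d=r..M. h d - h (Suc d)) = h r - h (Suc M)"
        using sum_Suc_diff[of r M "\<lambda>d. - h d"] r by simp
      also have "q ^ r / \<mu> ^ (2 * k) * (h r - h (Suc M)) \<le> q ^ r / \<mu> ^ (2 * k) * h r"
        using q \<mu> h1[of "Suc M"] by (intro mult_left_mono) auto
      finally show ?thesis by simp
    qed
    also have "\<dots> = (1 - q ^ r) * (\<mu>\<^sup>2 * w r * h r / (\<mu> ^ (2 * Suc k) * (1 - q)))"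
      using q \<mu> pow[of r] r by (simp add: w_def power2_eq_square)
    also have "\<dots> \<le> (1 - q ^ r) * (((h (r - 1) - h r) - (h r - h (Suc r))) / (\<mu> ^ (2 * Suc k) * (1 - q)))"
      using h_convex[of r] r q \<mu> pow0 by (intro mult_left_mono divide_right_mono) auto
    also have "\<dots> = (1 - q ^ r) * (H (Suc k) r - H (Suc k) (Suc r))"
      unfolding H_def by (simp only: nat.simps if_False diff_divide_distrib diff_Suc_1)
    finally show "(1 - q) * (\<Sum>d=r..M. q ^ d * H k (Suc d)) \<le> (1 - q ^ r) * (H (Suc k) r - H (Suc k) (Suc r))" .
  qed
  also have "h 0 = exp (\<mu> * (\<Sum>t=1..n. sqrt ((1 - q) * q ^ t / (1 - q ^ t))))"
    unfolding h_def w_def by (simp add: atLeastSucAtMost_greaterThanAtMost)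
  finally show ?thesis .
qed

section \<open>Elementary estimates for powers, products and the weight sum\<close>

lemma power_mult_one_plus_le:
  assumes "0 < q" "q < (1::real)"
  shows "q ^ j * (1 + real j * (1 - q)) \<le> 1"
proof (induction j)
  case (Suc j)
  have "q * (1 + real (Suc j) * (1 - q)) \<le> 1 + real j * (1 - q)"
  proof -
    have "0 \<le> (1 - q)\<^sup>2 * (1 + real j)" using assms by simp
    then show ?thesis by (simp add: algebra_simps power2_eq_square)
  qed
  then have "q ^ j * (q * (1 + real (Suc j) * (1 - q))) \<le> q ^ j * (1 + real j * (1 - q))"
    using assms by (intro mult_left_mono) auto
  then show ?case using Suc.IH by (simp add: mult_ac)
qed simp

text \<open>Combines the bound q^j <= 1/(1+y), where y = j(1-q), with y/(1+y) >= min(1,y)/2.\<close>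

lemma one_minus_power_ge:
  assumes "0 < q" "q < (1::real)"
  shows "min 1 (real j * (1 - q)) / 2 \<le> 1 - q ^ j"
proof -
  let ?y = "real j * (1 - q)"
  have y: "0 \<le> ?y" using assms by simp
  have "q ^ j \<le> 1 / (1 + ?y)"
    using power_mult_one_plus_le[OF assms, of j] y by (simp add: pos_le_divide_eq)
  moreover have "min 1 ?y / 2 \<le> 1 - 1 / (1 + ?y)"
  proof -
    have "min 1 z * (1 + z) \<le> 2 * z" if "0 \<le> z" for z :: real
      using that mult_left_le[of z z] by (auto simp: min_def algebra_simps)
    from this[OF y] have "min 1 ?y * (1 + ?y) \<le> 2 * ?y" .
    then show ?thesis using y by (simp add: field_simps)
  qed
  ultimately show ?thesis by linarith
qed

text \<open>A crude Stirling bound: keep one term of the series for exp M.\<close>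

lemma power_le_fact_mult_exp: "real M ^ M \<le> fact M * exp (real M)"
proof -
  have s: "(\<lambda>n. real M ^ n / fact n) sums exp (real M)"
    using exp_converges[of "real M"] by (simp add: divide_inverse mult.commute)
  have "sum (\<lambda>n. real M ^ n / fact n) {M} \<le> (\<Sum>n. real M ^ n / fact n)"
    by (rule sum_le_suminf[OF sums_summable[OF s]]) auto
  then have "sum (\<lambda>n. real M ^ n / fact n) {M} \<le> exp (real M)"
    unfolding sums_unique[OF s, symmetric] .
  then show ?thesis by (simp add: field_simps)
qed

text \<open>Only about 1/x factors are below 1, so the bound is uniform in \<open>K\<close>.
  Replacing \<open>x\<close> by 1/M with an integer M between 1/x and 1/x + 1 makes the product
  M!/M^M, which is at least exp(-M).\<close>

lemma prod_min_ge:
  assumes x: "0 < x" "x \<le> (1::real)"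
  shows "exp (- (1 / x + 1)) \<le> (\<Prod>j<K. min 1 (real (Suc j) * x))"
proof -
  define M where "M = nat \<lfloor>1 / x\<rfloor> + 1"
  have M: "1 / x \<le> real M" "real M \<le> 1 / x + 1"
    unfolding M_def using x by (auto; linarith)+
  have M0: "0 < real M" by (simp add: M_def)
  define g where "g j = min 1 (real (Suc j) / real M)" for j
  have g: "0 \<le> g j" "g j \<le> 1" for j by (auto simp: g_def)
  have "exp (- (1 / x + 1)) \<le> exp (- real M)" using M by simp
  also have "\<dots> \<le> fact M / real M ^ M"
    using power_le_fact_mult_exp[of M] M0 by (simp add: exp_minus field_simps)
  also have "\<dots> = (\<Prod>j<M. real (Suc j) / real M)"
    by (simp add: prod_dividef fact_prod_Suc atLeast0LessThan)
  also have "\<dots> = (\<Prod>j<M. g j)"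
    by (intro prod.cong) (auto simp: g_def min_def divide_le_eq)
  also have "\<dots> \<le> (\<Prod>j<K. g j)"
  proof (cases "K \<le> M")
    case True
    have "(\<Prod>j<M. g j) = (\<Prod>j<K. g j) * (\<Prod>j\<in>{K..<M}. g j)"
      using True by (subst prod.union_disjoint[symmetric]) (auto intro!: prod.cong)
    also have "\<dots> \<le> (\<Prod>j<K. g j) * 1"
      using g by (intro mult_left_mono prod_le_1 prod_nonneg) auto
    finally show ?thesis by simp
  next
    case False
    have "(\<Prod>j<M. g j) = (\<Prod>j<K. g j)"
      using False M0 by (intro prod.mono_neutral_left) (auto simp: g_def min_def divide_le_eq)
    then show ?thesis by simp
  qed
  also have "\<dots> \<le> (\<Prod>j<K. min 1 (real (Suc j) * x))"
  proof (intro prod_mono conjI g)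
    fix j
    have "1 / real M \<le> x" using M(1) M0 x by (simp add: field_simps)
    then have "real (Suc j) * (1 / real M) \<le> real (Suc j) * x" by (intro mult_left_mono) auto
    then show "g j \<le> min 1 (real (Suc j) * x)" by (simp add: g_def min_def)
  qed
  finally show ?thesis .
qed

lemma prod_one_minus_power_ge:
  assumes q: "0 < q" "q < (1::real)"
  shows "exp (- (1 / (1 - q) + 1)) / 2 ^ K \<le> (\<Prod>j<K. 1 - q ^ Suc j)"
proof -
  have "exp (- (1 / (1 - q) + 1)) / 2 ^ K \<le> (\<Prod>j<K. min 1 (real (Suc j) * (1 - q))) / 2 ^ K"
    using prod_min_ge[of "1 - q" K] q by (intro divide_right_mono) auto
  also have "\<dots> = (\<Prod>j<K. min 1 (real (Suc j) * (1 - q)) / 2)" by (simp add: prod_dividef)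
  also have "\<dots> \<le> (\<Prod>j<K. 1 - q ^ Suc j)"
    using q by (intro prod_mono conjI one_minus_power_ge) (auto simp: min_def)
  finally show ?thesis .
qed

lemma sum_inverse_sqrt_le: "(\<Sum>t=1..m. 1 / sqrt (real t)) \<le> 2 * sqrt (real m)"
proof (induction m)
  case (Suc m)
  have "1 / sqrt (real (Suc m)) \<le> 2 * (sqrt (real (Suc m)) - sqrt (real m))"
  proof -
    let ?a = "sqrt (real (Suc m))" and ?b = "sqrt (real m)"
    have "?a * ?a = real m + 1" "?b * ?b = real m" by simp_all
    moreover have "0 \<le> (?a - ?b) * (?a - ?b)" by simp
    ultimately have "1 \<le> 2 * (?a - ?b) * ?a" by (simp add: algebra_simps)
    then show ?thesis by (simp add: pos_divide_le_eq)
  qed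
  then show ?case using Suc.IH by simp
qed simp

text \<open>Split at t = 1/(1-q). Below it the weight is at most 1/t, and the inverse square roots
  sum to 2/sqrt(1-q). Above it 1 - q^t is at least 1/2, which leaves a geometric series of ratio
  sqrt(q). The total constant 2 + 2 sqrt(2) is below 5.\<close>

lemma sum_sqrt_weights_le:
  assumes q: "0 < q" "q < (1::real)"
  shows "(\<Sum>t=1..n. sqrt ((1 - q) * q ^ t / (1 - q ^ t))) \<le> 5 / sqrt (1 - q)"
proof -
  let ?x = "1 - q" and ?y = "sqrt q"
  have y: "0 \<le> ?y" "?y < 1" "?y * ?y = q" using q by auto
  have bound: "sqrt (?x * q ^ t / (1 - q ^ t)) \<le>
      (if real t * ?x \<le> 1 then 1 / sqrt (real t) else 0) + sqrt (2 * ?x) * ?y ^ t" if t: "t \<in> {1..n}" for t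
  proof -
    have pos: "0 < 1 - q ^ t" using t q by (simp add: power_less_one_iff)
    show ?thesis
    proof (cases "real t * ?x \<le> 1")
      case True
      have "q ^ t * (real t * ?x) \<le> 1 - q ^ t"
        using power_mult_one_plus_le[OF q, of t] by (simp add: algebra_simps)
      then have "?x * q ^ t / (1 - q ^ t) \<le> 1 / real t"
        using pos t by (simp add: field_simps)
      then have "sqrt (?x * q ^ t / (1 - q ^ t)) \<le> sqrt (1 / real t)" by (rule real_sqrt_le_mono)
      also have "\<dots> = 1 / sqrt (real t)" by (simp add: real_sqrt_divide)
      finally show ?thesis using True q y by (auto intro: add_increasing2)
    next
      case False
      then have "1 / 2 \<le> 1 - q ^ t" using one_minus_power_ge[OF q, of t] by simp
      then have "?x * q ^ t / (1 - q ^ t) \<le> ?x * q ^ t / (1 / 2)"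
        using q by (intro divide_left_mono) auto
      then have "sqrt (?x * q ^ t / (1 - q ^ t)) \<le> sqrt (2 * ?x * q ^ t)"
        by (intro real_sqrt_le_mono) (simp add: algebra_simps)
      then show ?thesis using False by (simp add: real_sqrt_mult real_sqrt_power)
    qed
  qed
  have "(\<Sum>t=1..n. sqrt (?x * q ^ t / (1 - q ^ t))) \<le>
      (\<Sum>t=1..n. if real t * ?x \<le> 1 then 1 / sqrt (real t) else 0) + sqrt (2 * ?x) * (\<Sum>t=1..n. ?y ^ t)"
    unfolding sum_distrib_left sum.distrib[symmetric] by (intro sum_mono bound)
  also have "\<dots> \<le> 2 / sqrt ?x + sqrt (2 * ?x) * (2 / ?x)"
  proof (intro add_mono mult_left_mono)
    define m where "m = nat \<lfloor>1 / ?x\<rfloor>"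
    have m: "real m \<le> 1 / ?x" unfolding m_def using q by simp
    have "(\<Sum>t=1..n. if real t * ?x \<le> 1 then 1 / sqrt (real t) else 0) =
        (\<Sum>t\<in>{t \<in> {1..n}. real t * ?x \<le> 1}. 1 / sqrt (real t))"
      by (rule sum.inter_filter[symmetric]) simp
    also have "\<dots> \<le> (\<Sum>t=1..m. 1 / sqrt (real t))"
    proof (rule sum_mono2)
      show "{t \<in> {1..n}. real t * ?x \<le> 1} \<subseteq> {1..m}"
      proof
        fix t assume "t \<in> {t \<in> {1..n}. real t * ?x \<le> 1}"
        then have "1 \<le> t" "real t \<le> 1 / ?x" using q by (auto simp: field_simps)
        then show "t \<in> {1..m}" unfolding m_def by (auto simp: le_nat_floor)
      qed
    qed auto
    also have "\<dots> \<le> 2 * sqrt (real m)" by (rule sum_inverse_sqrt_le)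
    also have "\<dots> \<le> 2 * sqrt (1 / ?x)" using m by simp
    finally show "(\<Sum>t=1..n. if real t * ?x \<le> 1 then 1 / sqrt (real t) else 0) \<le> 2 / sqrt ?x"
      by (simp add: real_sqrt_divide)
    have "(1 - ?y) * (\<Sum>t=1..n. ?y ^ t) \<le> 1"
      using geom_tail_le[OF y(1,2), of 1 n] y by (simp only: power_one_right)
    then have "(\<Sum>t=1..n. ?y ^ t) \<le> 1 / (1 - ?y)"
      using y by (simp only: pos_le_divide_eq diff_gt_0_iff_gt mult.commute)
    also have "\<dots> \<le> 2 / ?x"
    proof -
      have "?x = (1 - ?y) * (1 + ?y)" using y by (simp add: algebra_simps)
      also have "\<dots> \<le> (1 - ?y) * 2" using y by (intro mult_left_mono) auto
      finally show ?thesis using y q by (simp add: field_simps)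
    qed
    finally show "(\<Sum>t=1..n. ?y ^ t) \<le> 2 / ?x" .
    show "0 \<le> sqrt (2 * ?x)" using q by simp
  qed
  also have "sqrt (2 * ?x) * (2 / ?x) = 2 * sqrt 2 / sqrt ?x"
  proof -
    have "sqrt (2 * z) * (2 / z) = 2 * sqrt 2 / sqrt z" if "0 < z" for z :: real
      using that by (simp add: real_sqrt_mult field_simps)
    from this[of ?x] show ?thesis using q by simp
  qed
  also have "2 / sqrt ?x + 2 * sqrt 2 / sqrt ?x \<le> 5 / sqrt ?x"
  proof -
    have "sqrt 2 \<le> 3 / 2" by (rule real_le_lsqrt) (auto simp: power2_eq_square)
    then show ?thesis using q by (simp add: add_divide_distrib[symmetric] divide_right_mono)
  qed
  finally show ?thesis .
qed

section \<open>The three upper tail bounds\<close>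

lemma exp_nat_le: "exp (real k * real L) \<le> (3 ^ k) ^ L"
proof -
  have "exp (real k * real L) = (exp 1 ^ k) ^ L"
    by (simp add: exp_of_nat_mult[symmetric] power_mult[symmetric])
  also have "\<dots> \<le> (3 ^ k) ^ L" using exp_le by (intro power_mono) auto
  finally show ?thesis .
qed

lemma upper_tail_small:
  assumes q: "0 < q" "q < 1 - 2 / real n" and n: "n \<ge> 2" and L: "L \<ge> 2" "real L \<le> 3 / (1 - q)"
    and C: "C \<ge> 3 ^ 5"
  shows "mallows_prob n q (\<lambda>p. LDS n p \<ge> L) \<le> real n ^ 8 * (C / ((1 - q) * real L ^ 2)) ^ L"
proof -
  let ?x = "1 - q"
  have q1: "q < 1" using q n by (smt (verit) divide_nonneg_nonneg of_nat_0_le_iff)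
  obtain K where K: "L = Suc K" "1 \<le> K" using L by (cases L) auto
  \<comment> \<open>This choice makes the exponent at most 5L while the denominator becomes a power
    of (1-q)L^2.\<close>
  define \<mu> where "\<mu> = real L * sqrt ?x"
  have \<mu>: "0 < \<mu>" "\<mu>\<^sup>2 = ?x * real L ^ 2"
    using L q1 by (auto simp: \<mu>_def power_mult_distrib)
  have "mallows_prob n q (\<lambda>p. LDS n p \<ge> L) \<le> real n *
      (exp (\<mu> * (\<Sum>t=1..n. sqrt (?x * q ^ t / (1 - q ^ t)))) / (\<mu> ^ (2 * K) * ?x))"
    unfolding K using mallows_prob_LDS_le_exp[OF q(1) q1 \<mu>(1) K(2)] .
  also have "\<dots> \<le> real n * (exp (5 * real L) / (\<mu> ^ (2 * K) * ?x))"
  proof -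
    have "\<mu> * (\<Sum>t=1..n. sqrt (?x * q ^ t / (1 - q ^ t))) \<le> \<mu> * (5 / sqrt ?x)"
      using sum_sqrt_weights_le[OF q(1) q1] \<mu> by (intro mult_left_mono) auto
    also have "\<dots> = 5 * real L" using q1 by (simp add: \<mu>_def)
    finally show ?thesis using \<mu> q1 by (intro mult_left_mono divide_right_mono) auto
  qed
  also have "\<dots> = real n * real L ^ 2 * (exp (5 * real L) / (?x * real L ^ 2) ^ L)"
  proof -
    have "\<mu> ^ (2 * K) = (?x * real L ^ 2) ^ K" by (simp add: power_mult \<mu>(2))
    then show ?thesis using q1 L unfolding K by (simp add: field_simps)
  qed
  also have "\<dots> \<le> real n ^ 8 * (C ^ L / (?x * real L ^ 2) ^ L)"
  proof (intro mult_mono divide_right_mono)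
    have "exp (5 * real L) \<le> (3 ^ 5) ^ L" using exp_nat_le[of 5 L] by simp
    also have "\<dots> \<le> C ^ L" using C by (intro power_mono) auto
    finally show "exp (5 * real L) \<le> C ^ L" .
    \<comment> \<open>The denominator has only L - 1 powers, which leaves a factor n L^2. As L <=
      3/(1-q) and 1/(1-q) <= n/2, it is at most 4 n^3, hence at most n^5.\<close>
    have "1 / ?x \<le> real n / 2" using q n q1 by (simp add: field_simps)
    then have "real L \<le> 2 * real n" using L by simp
    then have "real n * real L ^ 2 \<le> real n * (2 * real n) ^ 2" by (intro mult_left_mono power_mono) auto
    also have "\<dots> = 2 ^ 2 * real n ^ 3" by (simp add: power_mult_distrib power2_eq_square power3_eq_cube)
    also have "\<dots> \<le> real n ^ 2 * real n ^ 3" using n by (intro mult_right_mono power_mono) auto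
    also have "\<dots> \<le> real n ^ 8" unfolding power_add[symmetric] using n by (intro power_increasing) auto
    finally show "real n * real L ^ 2 \<le> real n ^ 8" .
  qed (use q1 in auto)
  finally show ?thesis by (simp add: power_divide)
qed

lemma upper_tail_large:
  assumes q: "0 < q" "q < 1 - 2 / real n" and n: "n \<ge> 2" and L: "L \<ge> 2" "real L > 3 / (1 - q)"
    and C: "C \<ge> 3 ^ 5"
  shows "mallows_prob n q (\<lambda>p. LDS n p \<ge> L) \<le>
    real n ^ 8 * ((C * (1 - q)) ^ L * q ^ (L * (L - 1) div 2))"
proof -
  let ?x = "1 - q" and ?Q = "q ^ (L * (L - 1) div 2)"
  have q1: "q < 1" using q n by (smt (verit) divide_nonneg_nonneg of_nat_0_le_iff)
  obtain K where K: "L = Suc K" "1 \<le> K" using L by (cases L) auto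
  let ?P = "\<Prod>j<K. 1 - q ^ Suc j"
  have P: "exp (- (1 / ?x + 1)) / 2 ^ K \<le> ?P" by (rule prod_one_minus_power_ge[OF q(1) q1])
  have "mallows_prob n q (\<lambda>p. LDS n p \<ge> L) \<le> real n * (?x ^ K * ?Q / ?P ^ 3)"
    using mallows_prob_LDS_le_prod[OF q(1) q1, of n K] K by simp
  also have "\<dots> \<le> real n * (?x ^ K * ?Q / (exp (- (1 / ?x + 1)) / 2 ^ K) ^ 3)"
  proof -
    have "0 < ?P" by (rule less_le_trans[OF _ P]) simp
    then show ?thesis
      using P q q1 by (intro mult_left_mono divide_left_mono power_mono mult_pos_pos zero_less_power) auto
  qed
  also have "\<dots> = real n * (?x ^ K * ?Q * (exp (3 / ?x + 3) * 8 ^ K))"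
  proof -
    have "exp (3 * (1 / ?x + 1)) = exp (1 / ?x + 1) ^ 3"
      using exp_of_nat_mult[of 3 "1 / ?x + 1"] by simp
    then have "exp (3 / ?x + 3) = exp (1 / ?x + 1) ^ 3" by (simp add: distrib_left)
    moreover have "(8::real) ^ K = (2 ^ K) ^ 3"
      using power_mult[of "2::real" K 3] power_mult[of "2::real" 3 K] by (simp add: mult.commute)
    moreover have "(exp (- z) / 2 ^ K) ^ 3 = 1 / (exp z ^ 3 * (2 ^ K) ^ 3)" for z :: real
      by (simp add: exp_minus power_divide power_inverse inverse_eq_divide power_mult_distrib)
    ultimately show ?thesis by (simp only:) simp
  qed
  also have "\<dots> \<le> real n * (?x ^ K * ?Q * ((3 ^ 3) ^ L * 8 ^ L))"
  proof -
    \<comment> \<open>Both L > 3/(1-q) and L >= 2 enter: the exponent is below L + 2L. With the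
      factor 8^K this yields the base 27 * 8 = 216.\<close>
    have "exp (3 / ?x + 3) \<le> exp (real 3 * real L)" using L by simp
    also have "\<dots> \<le> (3 ^ 3) ^ L" by (rule exp_nat_le)
    finally have "exp (3 / ?x + 3) \<le> (3 ^ 3) ^ L" .
    moreover have "(8::real) ^ K \<le> 8 ^ L" using K by simp
    ultimately show ?thesis using q q1 by (intro mult_left_mono mult_mono) auto
  qed
  also have "\<dots> = real n * (1 / ?x) * ((216 * ?x) ^ L * ?Q)"
  proof -
    have "((3::real) ^ 3) ^ L * 8 ^ L = 216 ^ L" by (simp flip: power_mult_distrib)
    moreover have "?x ^ K = ?x ^ L / ?x" using K q1 by simp
    ultimately show ?thesis by (simp only: power_mult_distrib) simp
  qed
  also have "\<dots> \<le> real n ^ 8 * ((C * ?x) ^ L * ?Q)"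
  proof (intro mult_mono)
    have "1 / ?x \<le> real n / 2" using q n q1 by (simp add: field_simps)
    then have "real n * (1 / ?x) \<le> real n * real n" by (intro mult_left_mono) auto
    also have "\<dots> = real n ^ 2" by (simp add: power2_eq_square)
    also have "\<dots> \<le> real n ^ 8" using n by (intro power_increasing) auto
    finally show "real n * (1 / ?x) \<le> real n ^ 8" .
    show "(216 * ?x) ^ L \<le> (C * ?x) ^ L" using C q1 by (intro power_mono mult_right_mono) auto
  qed (use q q1 C in auto)
  finally show ?thesis .
qed

text \<open>Here every factor 1 - q^(j+1) is at least 1/2, so the cubed product costs only 8^K and
  no further power of n is lost.\<close>

lemma upper_tail_half:
  assumes q: "0 < q" "q < 1 / 2" and L: "L \<ge> 2" and C: "C \<ge> 8"
  shows "mallows_prob n q (\<lambda>p. LDS n p \<ge> L) \<le> real n * C ^ L * q ^ (L * (L - 1) div 2)"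
proof -
  let ?Q = "q ^ (L * (L - 1) div 2)"
  obtain K where K: "L = Suc K" using L by (cases L) auto
  let ?P = "\<Prod>j<K. 1 - q ^ Suc j"
  have "(1 / 2) ^ K = (\<Prod>j<K. 1 / 2 :: real)" by simp
  also have "\<dots> \<le> ?P"
  proof (intro prod_mono conjI)
    fix j
    have "q ^ Suc j \<le> q ^ 1" using q by (intro power_decreasing) auto
    then have "q ^ Suc j \<le> q" by (simp only: power_one_right)
    then show "1 / 2 \<le> 1 - q ^ Suc j" using q by linarith
  qed simp
  finally have P: "(1 / 2) ^ K \<le> ?P" .
  have P0: "0 < ?P" by (rule less_le_trans[OF _ P]) simp
  have "mallows_prob n q (\<lambda>p. LDS n p \<ge> L) \<le> real n * ((1 - q) ^ K * ?Q / ?P ^ 3)"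
    using mallows_prob_LDS_le_prod[of q n K] q K by simp
  also have "\<dots> \<le> real n * (1 * ?Q / ((1 / 2) ^ K) ^ 3)"
    using P P0 q
    by (intro mult_left_mono frac_le mult_right_mono power_mono) (auto simp: power_le_one)
  also have "\<dots> = real n * (8 ^ K * ?Q)"
  proof -
    have "(((1::real) / 2) ^ K) ^ 3 = 1 / 8 ^ K"
      using power_mult[of "2::real" K 3] power_mult[of "2::real" 3 K]
      by (simp add: mult.commute power_divide)
    then show ?thesis by simp
  qed
  also have "\<dots> \<le> real n * (C ^ L * ?Q)"
  proof -
    have "(8::real) ^ K \<le> 8 ^ L" using K by simp
    also have "\<dots> \<le> C ^ L" using C by (intro power_mono) auto
    finally show ?thesis using q by (intro mult_left_mono mult_right_mono) auto
  qed
  finally show ?thesis by (simp add: mult.assoc)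
qed

section \<open>Independent blocks and the lower tail\<close>

lemma dec_chains_append: "dec_chains r k ds > 0 \<Longrightarrow> dec_chains r k (ds @ ys) > 0"
  by (induction r k ds rule: dec_chains.induct) (auto split: if_splits)

text \<open>From rank 0 every entry can be skipped, as no code is below 0. From a positive rank a
  prefix could raise the rank.\<close>

lemma dec_chains_0_prepend: "dec_chains 0 k ds > 0 \<Longrightarrow> dec_chains 0 k (xs @ ds) > 0"
  by (induction xs; cases k) auto

lemma code_exp_of_bool_bounds:
  assumes "0 < q"
  shows "0 \<le> code_exp q s m (\<lambda>ds. of_bool (Q ds))" "code_exp q s m (\<lambda>ds. of_bool (Q ds)) \<le> 1"
proof -
  have "code_exp q s m (\<lambda>ds. 0) \<le> code_exp q s m (\<lambda>ds. of_bool (Q ds))"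
    using assms by (intro code_exp_mono) auto
  then show "0 \<le> code_exp q s m (\<lambda>ds. of_bool (Q ds))" using assms by (simp add: code_exp_const)
  have "code_exp q s m (\<lambda>ds. of_bool (Q ds)) \<le> code_exp q s m (\<lambda>ds. 1)"
    using assms by (intro code_exp_mono) auto
  then show "code_exp q s m (\<lambda>ds. of_bool (Q ds)) \<le> 1" using assms by (simp add: code_exp_const)
qed

lemma code_exp_not:
  "0 < q \<Longrightarrow> code_exp q s m (\<lambda>ds. of_bool (\<not> Q ds)) = 1 - code_exp q s m (\<lambda>ds. of_bool (Q ds))"
  by (simp only: of_bool_not_iff code_exp_diff code_exp_const)

text \<open>A chain inside one block is a chain of the whole code, so its absence forces absence in
  each of the \<open>N\<close> independent blocks. The bound \<open>b\<close> is uniform in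
  \<open>s\<close> because blocks start at different positions; the last \<open>j\<close> entries
  are left over.\<close>

lemma code_exp_no_chain_le:
  assumes q: "0 < q"
    and b: "\<And>s. b \<le> code_exp q s m (\<lambda>ds. of_bool (dec_chains 0 L ds > 0))"
  shows "code_exp q s (N * m + j) (\<lambda>ds. of_bool (\<not> dec_chains 0 L ds > 0)) \<le> (1 - b) ^ N"
proof (induction N arbitrary: s)
  case 0
  then show ?case using code_exp_of_bool_bounds(2)[OF q] by simp
next
  case (Suc N)
  have "code_exp q s (Suc N * m + j) (\<lambda>ds. of_bool (\<not> dec_chains 0 L ds > 0)) =
      code_exp q s (m + (N * m + j)) (\<lambda>ds. of_bool (\<not> dec_chains 0 L ds > 0))"
    by (simp add: add.assoc)
  also have "\<dots> \<le> code_exp q s (m + (N * m + j))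
      (\<lambda>ds. of_bool (\<not> dec_chains 0 L (take m ds) > 0) * of_bool (\<not> dec_chains 0 L (drop m ds) > 0))"
  proof (rule code_exp_mono[OF q])
    fix ds
    have "dec_chains 0 L ds > 0" if "dec_chains 0 L (take m ds) > 0 \<or> dec_chains 0 L (drop m ds) > 0"
      using that dec_chains_append[of 0 L "take m ds" "drop m ds"]
        dec_chains_0_prepend[of L "drop m ds" "take m ds"] by auto
    then show "(of_bool (\<not> dec_chains 0 L ds > 0) :: real) \<le>
        of_bool (\<not> dec_chains 0 L (take m ds) > 0) * of_bool (\<not> dec_chains 0 L (drop m ds) > 0)"
      by (auto simp: of_bool_def)
  qed
  also have "\<dots> = code_exp q s m (\<lambda>ds. of_bool (\<not> dec_chains 0 L ds > 0)) *
      code_exp q (s + m) (N * m + j) (\<lambda>ds. of_bool (\<not> dec_chains 0 L ds > 0))"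
    by (rule code_exp_split)
  also have "\<dots> \<le> (1 - b) * (1 - b) ^ N"
  proof (intro mult_mono Suc.IH code_exp_of_bool_bounds(1)[OF q])
    show "code_exp q s m (\<lambda>ds. of_bool (\<not> dec_chains 0 L ds > 0)) \<le> 1 - b"
      using b[of s] code_exp_not[OF q, of s m "\<lambda>ds. dec_chains 0 L ds > 0"] by linarith
    show "0 \<le> 1 - b"
      using b[of s] code_exp_of_bool_bounds(2)[OF q, of s m "\<lambda>ds. dec_chains 0 L ds > 0"] by linarith
  qed
  finally show ?case by simp
qed

lemma mallows_prob_LDS_ge_blocks:
  assumes q: "0 < q" and N: "N * m \<le> n"
    and b: "\<And>s. b \<le> code_exp q s m (\<lambda>ds. of_bool (dec_chains 0 L ds > 0))"
  shows "1 - (1 - b) ^ N \<le> mallows_prob n q (\<lambda>p. LDS n p \<ge> L)"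
proof -
  have "code_exp q 0 n (\<lambda>ds. of_bool (\<not> dec_chains 0 L ds > 0)) \<le> (1 - b) ^ N"
    using code_exp_no_chain_le[OF q b, of 0 N "n - N * m"] N by simp
  then show ?thesis unfolding mallows_prob_LDS_ge[OF q] code_exp_not[OF q] by linarith
qed

section \<open>Long chains inside a single block\<close>

text \<open>Truncating a geometric variable only increases the weights of the values that
  remain.\<close>

lemma code_weight_ge:
  assumes "0 < q" "q < (1::real)"
  shows "(1 - q) * q ^ d \<le> q ^ d / (\<Sum>e\<le>s. q ^ e)"
proof -
  have "(1 - q) * (\<Sum>e\<le>s. q ^ e) = 1 - q ^ Suc s"
    unfolding lessThan_Suc_atMost[symmetric] by (rule geom_sum_mult)
  then have "(1 - q) * (\<Sum>e\<le>s. q ^ e) \<le> 1" using assms by simp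
  then have "q ^ d * ((1 - q) * (\<Sum>e\<le>s. q ^ e)) \<le> q ^ d * 1"
    using assms by (intro mult_left_mono) auto
  then show ?thesis using sum_powers_pos[OF assms(1), of s] by (simp add: pos_le_divide_eq mult_ac)
qed

text \<open>Keep only the path whose codes are r, r+1, ...: each new entry lies just below the
  previous one among the entries seen, and the rank grows by one.\<close>

lemma code_exp_all_chain_ge:
  assumes q: "0 < q" "q < 1"
  shows "r \<le> s \<Longrightarrow> (\<Prod>j<k. (1 - q) * q ^ (r + j)) \<le>
    code_exp q s k (\<lambda>ds. of_bool (dec_chains r k ds > 0))"
proof (induction k arbitrary: r s)
  case (Suc k)
  let ?E = "\<lambda>d. code_exp q (Suc s) k (\<lambda>ds. of_bool (dec_chains r (Suc k) (d # ds) > 0))"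
  have w: "0 \<le> q ^ d / (\<Sum>e\<le>s. q ^ e)" for d using q sum_powers_pos[OF q(1), of s] by simp
  have "(\<Prod>j<Suc k. (1 - q) * q ^ (r + j)) = (1 - q) * q ^ r * (\<Prod>j<k. (1 - q) * q ^ (Suc r + j))"
    by (subst prod.lessThan_Suc_shift) simp
  also have "\<dots> \<le> q ^ r / (\<Sum>e\<le>s. q ^ e) * code_exp q (Suc s) k (\<lambda>ds. of_bool (dec_chains (Suc r) k ds > 0))"
    using Suc.prems q w by (intro mult_mono code_weight_ge Suc.IH prod_nonneg) auto
  also have "\<dots> \<le> q ^ r / (\<Sum>e\<le>s. q ^ e) * ?E r"
    using w by (intro mult_left_mono code_exp_mono[OF q(1)]) auto
  also have "\<dots> \<le> (\<Sum>d\<le>s. q ^ d / (\<Sum>e\<le>s. q ^ e) * ?E d)"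
    using Suc.prems w code_exp_of_bool_bounds(1)[OF q(1)]
    by (intro member_le_sum[where f = "\<lambda>d. q ^ d / (\<Sum>e\<le>s. q ^ e) * ?E d"] mult_nonneg_nonneg) auto
  finally show ?case by simp
qed simp

lemma lower_tail_consecutive:
  assumes q: "0 < q" "q < 1"
  shows "1 - (1 - q ^ (L * (L - 1) div 2) * (1 - q) ^ L) ^ (n div L) \<le>
    mallows_prob n q (\<lambda>p. LDS n p \<ge> L)"
proof (rule mallows_prob_LDS_ge_blocks[OF q(1)])
  show "n div L * L \<le> n" by simp
  fix s
  have "(\<Prod>j<L. q ^ j) = q ^ (L * (L - 1) div 2)"
  proof (cases L)
    case (Suc K)
    have "(\<Prod>j<L. q ^ j) = q ^ (\<Sum>{0..K})"
      by (simp add: Suc power_sum atLeast0AtMost lessThan_Suc_atMost)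
    then show ?thesis by (simp add: Suc gauss_sum_nat mult.commute)
  qed simp
  then have "q ^ (L * (L - 1) div 2) * (1 - q) ^ L = (\<Prod>j<L. (1 - q) * q ^ (0 + j))"
    by (simp add: prod.distrib)
  also have "\<dots> \<le> code_exp q s L (\<lambda>ds. of_bool (dec_chains 0 L ds > 0))"
    using code_exp_all_chain_ge[OF q, of 0 s L] by simp
  finally show "q ^ (L * (L - 1) div 2) * (1 - q) ^ L \<le>
      code_exp q s L (\<lambda>ds. of_bool (dec_chains 0 L ds > 0))" .
qed

text \<open>Greedy extension: accepting only the next \<open>g\<close> ranks below the current minimum, each step
  succeeds with probability at least \<open>p\<close>, so the number of successes dominates a binomial variable.\<close>

lemma code_exp_chain_ge_binomial:
  assumes q: "0 < q" "q < 1" and p: "0 \<le> p" "p \<le> 1" "p \<le> real g * ((1 - q) * q ^ R)"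
  shows "r + m + k * g \<le> s \<Longrightarrow> r + m + k * g \<le> R \<Longrightarrow>
    real (m choose k) * p ^ k * (1 - p) ^ (m - k) \<le>
    code_exp q s m (\<lambda>ds. of_bool (dec_chains r k ds > 0))"
proof (induction m arbitrary: r k s)
  case 0
  then show ?case by (cases k) auto
next
  case (Suc m)
  show ?case
  proof (cases k)
    case 0
    then show ?thesis
      using power_le_one[of "1 - p" "Suc m"] p q
      by (simp add: code_exp_const del: code_exp.simps power_Suc)
  next
    case (Suc k')
    define b where "b m k = real (m choose k) * p ^ k * (1 - p) ^ (m - k)" for m k
    define w where "w d = q ^ d / (\<Sum>e\<le>s. q ^ e)" for d
    define X where "X = b m k"
    \<comment> \<open>The maximum makes Y - X nonnegative, so that \<open>p\<close> can later be
      replaced by the true, larger acceptance probability.\<close>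
    define Y where "Y = max X (b m k')"
    let ?E = "\<lambda>d. code_exp q (Suc s) m (\<lambda>ds. of_bool (dec_chains r k (d # ds) > 0))"
    have w0: "0 \<le> w d" for d using q sum_powers_pos[OF q(1), of s] by (simp add: w_def)
    \<comment> \<open>Whatever the first code is, the chain can go on without it, at rank at most r
      + 1.\<close>
    have EX: "X \<le> ?E d" if "d \<le> s" for d
    proof (cases "d < r")
      case True
      have "X \<le> code_exp q (Suc s) m (\<lambda>ds. of_bool (dec_chains (Suc r) k ds > 0))"
        unfolding X_def b_def using Suc.prems by (intro Suc.IH) auto
      then show ?thesis using True Suc by simp
    next
      case False
      have "X \<le> code_exp q (Suc s) m (\<lambda>ds. of_bool (dec_chains r k ds > 0))"
        unfolding X_def b_def using Suc.prems by (intro Suc.IH) auto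
      also have "\<dots> \<le> ?E d" using False Suc by (intro code_exp_mono[OF q(1)]) auto
      finally show ?thesis .
    qed
    have EY: "Y \<le> ?E d" if d: "d \<in> {r..<r + g}" "d \<le> s" for d
    proof -
      have "b m k' \<le> code_exp q (Suc s) m (\<lambda>ds. of_bool (dec_chains (Suc d) k' ds > 0))"
        unfolding b_def using Suc.prems d Suc by (intro Suc.IH) auto
      also have "\<dots> \<le> ?E d" using d Suc by (intro code_exp_mono[OF q(1)]) auto
      finally show ?thesis using EX[OF d(2)] by (simp add: Y_def)
    qed
    have sub: "{r..<r + g} \<subseteq> {..s}" using Suc.prems Suc by auto
    have "p \<le> (\<Sum>d\<in>{r..<r + g}. (1 - q) * q ^ R)" using p by simp
    also have "\<dots> \<le> (\<Sum>d\<in>{r..<r + g}. w d)"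
    proof (rule sum_mono)
      fix d assume d: "d \<in> {r..<r + g}"
      have "q ^ R \<le> q ^ d" using q d Suc.prems Suc by (intro power_decreasing) auto
      then have "(1 - q) * q ^ R \<le> (1 - q) * q ^ d" using q by (intro mult_left_mono) auto
      also have "\<dots> \<le> w d" unfolding w_def by (rule code_weight_ge[OF q])
      finally show "(1 - q) * q ^ R \<le> w d" .
    qed
    finally have pw: "p \<le> (\<Sum>d\<in>{r..<r + g}. w d)" .
    \<comment> \<open>Pascal's rule; for k > m the term \<open>X\<close> vanishes.\<close>
    have "b (Suc m) k = p * b m k' + (1 - p) * X"
    proof (cases "k \<le> m")
      case True
      then have "m - k' = Suc (m - k)" using Suc by simp
      then show ?thesis using Suc by (simp add: b_def X_def algebra_simps)
    next
      case False
      then show ?thesis using Suc by (simp add: b_def X_def binomial_eq_0)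
    qed
    also have "\<dots> \<le> X + p * (Y - X)"
    proof -
      have "p * b m k' \<le> p * Y" using p by (intro mult_left_mono) (auto simp: Y_def)
      then show ?thesis by (simp add: algebra_simps)
    qed
    also have "\<dots> \<le> X + (\<Sum>d\<in>{r..<r + g}. w d) * (Y - X)"
      using pw by (intro add_left_mono mult_right_mono) (auto simp: Y_def)
    also have "\<dots> = (\<Sum>d\<le>s. w d * (X + (if d \<in> {r..<r + g} then Y - X else 0)))"
    proof -
      have "(\<Sum>d\<le>s. w d * (if d \<in> {r..<r + g} then Y - X else 0)) = (\<Sum>d\<in>{r..<r + g}. w d * (Y - X))"
        using sub by (intro sum.mono_neutral_cong_right) auto
      moreover have "(\<Sum>d\<le>s. w d * X) = X"
        by (simp only: w_def sum_distrib_right[symmetric] code_weights_sum[OF q(1)] mult_1)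
      ultimately show ?thesis by (simp only: distrib_left sum.distrib sum_distrib_right)
    qed
    also have "\<dots> \<le> (\<Sum>d\<le>s. w d * ?E d)"
      using EX EY w0 by (intro sum_mono mult_left_mono) auto
    finally show ?thesis by (simp add: b_def w_def)
  qed
qed

text \<open>A burn-in: the greedy bound needs many earlier positions, while a block bound must hold
  from every start, so each block sacrifices its first \<open>a\<close> entries.\<close>

lemma code_exp_drop_chain_le:
  assumes q: "0 < q"
  shows "code_exp q (s + a) m (\<lambda>ds. of_bool (dec_chains 0 L ds > 0)) \<le>
    code_exp q s (a + m) (\<lambda>ds. of_bool (dec_chains 0 L ds > 0))"
proof -
  have "code_exp q (s + a) m (\<lambda>ds. of_bool (dec_chains 0 L ds > 0)) =
      code_exp q s (a + m) (\<lambda>ds. 1 * of_bool (dec_chains 0 L (drop a ds) > 0))"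
    using code_exp_split[of q s a m "\<lambda>_. 1" "\<lambda>ds. of_bool (dec_chains 0 L ds > 0)"]
    by (simp add: code_exp_const[OF q])
  also have "\<dots> \<le> code_exp q s (a + m) (\<lambda>ds. of_bool (dec_chains 0 L ds > 0))"
  proof (rule code_exp_mono[OF q])
    fix ds show "1 * of_bool (dec_chains 0 L (drop a ds) > 0) \<le> (of_bool (dec_chains 0 L ds > 0) :: real)"
      using dec_chains_0_prepend[of L "drop a ds" "take a ds"] by auto
  qed
  finally show ?thesis .
qed

lemma half_le_floor: "x / 2 \<le> real (nat \<lfloor>x\<rfloor>)" if "1 \<le> (x::real)"
proof -
  have "1 \<le> real_of_int \<lfloor>x\<rfloor>" using that by simp
  moreover have "x < real_of_int \<lfloor>x\<rfloor> + 1" by linarith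
  moreover have "real (nat \<lfloor>x\<rfloor>) = real_of_int \<lfloor>x\<rfloor>" using that by simp
  ultimately show ?thesis by linarith
qed

text \<open>For q >= 1/2 one has 1/q <= exp(2(1-q)), hence q^k >= exp(-4) >= 3^(-4).\<close>

lemma power_ge_of_mult_le:
  assumes q: "1 / 2 \<le> q" "q < (1::real)" and k: "real k * (1 - q) \<le> 2"
  shows "1 / 81 \<le> q ^ k"
proof -
  have "1 / q \<le> 1 + 2 * (1 - q)"
  proof -
    have "0 \<le> (1 - q) * (2 * q - 1)" using q by (intro mult_nonneg_nonneg) auto
    then show ?thesis using q by (simp add: field_simps)
  qed
  also have "\<dots> \<le> exp (2 * (1 - q))" by (rule exp_ge_add_one_self)
  finally have "(1 / q) ^ k \<le> exp (2 * (1 - q)) ^ k" using q by (intro power_mono) auto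
  also have "\<dots> = exp (2 * (real k * (1 - q)))" by (simp add: exp_of_nat_mult[symmetric] mult_ac)
  also have "\<dots> \<le> exp (real 4 * real 1)" using k by simp
  also have "\<dots> \<le> (3 ^ 4) ^ 1" by (rule exp_nat_le)
  finally show ?thesis using q by (simp add: power_divide field_simps)
qed

lemma one_minus_power_ge_exp:
  fixes p :: real assumes "0 \<le> p" "p \<le> 1 / 2" shows "exp (- (2 * p * real T)) \<le> (1 - p) ^ T"
proof -
  have "1 / (1 - p) \<le> 1 + 2 * p"
  proof -
    have "0 \<le> p * (1 - 2 * p)" using assms by simp
    then show ?thesis using assms by (simp add: field_simps)
  qed
  also have "\<dots> \<le> exp (2 * p)" by (rule exp_ge_add_one_self)
  finally have "exp (- (2 * p)) \<le> 1 - p" using assms by (simp add: exp_minus field_simps)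
  then have "exp (- (2 * p)) ^ T \<le> (1 - p) ^ T" by (intro power_mono) auto
  then show ?thesis by (simp add: exp_of_nat_mult[symmetric] mult_ac)
qed

lemma lower_tail_moderate:
  assumes q: "1 / 2 \<le> q" "q < 1" and L: "1 / sqrt (1 - q) \<le> real L" "real L \<le> 1 / (1 - q)"
    and c: "0 < c" "c \<le> 1 / 972"
  shows "1 - (1 - (c / ((1 - q) * real L ^ 2)) ^ L) ^ nat \<lfloor>real n * (1 - q) / 4\<rfloor> \<le>
    mallows_prob n q (\<lambda>p. LDS n p \<ge> L)"
proof -
  define \<beta> where "\<beta> = 1 / (1 - q)"
  have \<beta>: "2 \<le> \<beta>" "(1 - q) * \<beta> = 1" using q by (auto simp: \<beta>_def field_simps)
  have sqrt_pos: "0 < 1 / sqrt (1 - q)" using q by simp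
  then have L0: "0 < real L" using L by linarith
  have L1: "real L \<le> \<beta>" using L by (simp add: \<beta>_def)
  have L2: "\<beta> \<le> real L ^ 2"
  proof -
    have "(1 / sqrt (1 - q)) ^ 2 \<le> real L ^ 2" using L sqrt_pos by (intro power_mono) auto
    then show ?thesis using q by (simp add: \<beta>_def power_divide)
  qed
  \<comment> \<open>\<open>T\<close> greedy steps with window \<open>g\<close> reach ranks up to
    \<open>R\<close>, at most 2/(1-q). There q^R >= 1/81, which explains the 81 in \<open>p\<close>.
    A block of length \<open>m\<close> has room for \<open>T\<close> steps after a burn-in of at
    least \<open>R\<close>.\<close>
  define T where "T = nat \<lfloor>\<beta>\<rfloor>"
  define g where "g = nat \<lfloor>\<beta> / real L\<rfloor>"
  define m where "m = nat \<lfloor>4 * \<beta>\<rfloor>"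
  define R where "R = T + L * g"
  define p where "p = real g * (1 - q) / 81"
  have T: "\<beta> / 2 \<le> real T" "real T \<le> \<beta>" unfolding T_def using \<beta> half_le_floor[of \<beta>] by auto
  have LT: "L \<le> T" unfolding T_def using L1 by (simp add: le_nat_floor)
  have ge1: "1 \<le> \<beta> / real L" using L0 L1 by simp
  have g: "\<beta> / real L / 2 \<le> real g" "real g \<le> \<beta> / real L"
    unfolding g_def using half_le_floor[OF ge1] ge1 by auto
  have Lg: "real L * real g \<le> \<beta>" using g(2) L0 by (simp add: field_simps)
  have R: "real R \<le> 2 * \<beta>" using Lg T by (simp add: R_def)
  have "T + R \<le> m"
    unfolding m_def
  proof (rule le_nat_floor)
    show "real (T + R) \<le> 4 * \<beta>" using R T \<beta> by simp
  qed
  then obtain a where a: "m = a + T" "R \<le> a" by (metis add.commute le_add_diff_inverse2 le_diff_conv2 add_leD1)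
  have "real R * (1 - q) \<le> 2 * \<beta> * (1 - q)" using R q by (intro mult_right_mono) auto
  also have "\<dots> = 2 * ((1 - q) * \<beta>)" by simp
  also have "\<dots> = 2" by (simp only: \<beta>(2) mult_1_right)
  finally have qR: "1 / 81 \<le> q ^ R" by (rule power_ge_of_mult_le[OF q])
  have p0: "0 \<le> p" unfolding p_def using q by simp
  have p_le: "p \<le> real g * ((1 - q) * q ^ R)"
  proof -
    have "real g * (1 - q) * (1 / 81) \<le> real g * (1 - q) * q ^ R"
      using qR q by (intro mult_left_mono) auto
    then show ?thesis by (simp add: p_def mult_ac)
  qed
  have pT: "p * real T \<le> real L / 81"
  proof -
    have "p * real T \<le> p * \<beta>" using T p0 by (intro mult_left_mono) auto
    also have "\<dots> = real g * ((1 - q) * \<beta>) / 81" by (simp add: p_def)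
    also have "\<dots> = real g / 81" by (simp only: \<beta>(2) mult_1_right)
    \<comment> \<open>This is where L >= 1/sqrt(1-q) is used: it bounds the expected number of
      successes by a multiple of L.\<close>
    also have "real g \<le> real L"
    proof -
      have "\<beta> / real L \<le> real L" using L2 L0 by (simp add: field_simps power2_eq_square)
      then show ?thesis using g by simp
    qed
    finally show ?thesis by simp
  qed
  have p1: "p \<le> 1 / 2"
  proof -
    have "real g * (1 - q) \<le> \<beta> * (1 - q)"
    proof (intro mult_right_mono)
      have "\<beta> / real L \<le> \<beta> / 1" using L0 \<beta> by (intro divide_left_mono) auto
      then show "real g \<le> \<beta>" using g by simp
    qed (use q in simp)
    then show ?thesis using \<beta>(2) by (simp add: p_def mult.commute)
  qed
  let ?b = "(c / ((1 - q) * real L ^ 2)) ^ L"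
  have "1 - (1 - ?b) ^ nat \<lfloor>real n * (1 - q) / 4\<rfloor> \<le> mallows_prob n q (\<lambda>p. LDS n p \<ge> L)"
  proof (rule mallows_prob_LDS_ge_blocks[where m = m])
    show "0 < q" using q by simp
    have "real (nat \<lfloor>real n * (1 - q) / 4\<rfloor>) * real m \<le> (real n * (1 - q) / 4) * (4 * \<beta>)"
      unfolding m_def using q \<beta>(1) by (intro mult_mono of_nat_floor) auto
    also have "\<dots> = real n * ((1 - q) * \<beta>)" by simp
    also have "\<dots> = real n" by (simp only: \<beta>(2) mult_1_right)
    finally show "nat \<lfloor>real n * (1 - q) / 4\<rfloor> * m \<le> n" by (metis of_nat_le_iff of_nat_mult)
  next
    fix s
    have "?b \<le> (\<beta> / (972 * real L ^ 2)) ^ L"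
    proof (rule power_mono)
      have "c / ((1 - q) * real L ^ 2) = c * \<beta> / real L ^ 2" by (simp add: \<beta>_def)
      also have "\<dots> \<le> 1 / 972 * \<beta> / real L ^ 2"
        using c \<beta> by (intro divide_right_mono mult_right_mono) auto
      finally show "c / ((1 - q) * real L ^ 2) \<le> \<beta> / (972 * real L ^ 2)" by simp
    qed (use c q in auto)
    \<comment> \<open>972 = 324 * 3. The 324 is 81 times a factor 2 for each of the two floors; the
      3 pays for the failures (1-p)^T, at least exp(-L).\<close>
    also have "\<dots> = (\<beta> / (324 * real L ^ 2)) ^ L * (1 / 3) ^ L" by (simp flip: power_mult_distrib)
    also have "\<dots> \<le> (real T / real L * p) ^ L * (1 - p) ^ T"
    proof (intro mult_mono power_mono)
      have "\<beta> / (324 * real L ^ 2) = (\<beta> / 2) / real L * (\<beta> / real L / 2 * (1 - q) / 81)"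
      proof -
        have "(\<beta> / 2) / real L * (\<beta> / real L / 2 * (1 - q) / 81) = \<beta> * ((1 - q) * \<beta>) / (324 * real L ^ 2)"
          by (simp add: power2_eq_square)
        then show ?thesis by (simp only: \<beta>(2) mult_1_right)
      qed
      also have "\<dots> \<le> real T / real L * p"
        unfolding p_def using T g q \<beta> by (intro mult_mono divide_right_mono) auto
      finally show "\<beta> / (324 * real L ^ 2) \<le> real T / real L * p" .
      have "(1 / 3 :: real) ^ L \<le> exp (- real L)"
        using exp_nat_le[of 1 L] by (simp add: power_divide exp_minus field_simps)
      also have "\<dots> \<le> exp (- (2 * p * real T))" using pT by simp
      also have "\<dots> \<le> (1 - p) ^ T" by (rule one_minus_power_ge_exp[OF p0 p1])
      finally show "(1 / 3 :: real) ^ L \<le> (1 - p) ^ T" .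
    qed (use \<beta> p0 in auto)
    also have "\<dots> \<le> real (T choose L) * p ^ L * (1 - p) ^ (T - L)"
    proof (intro mult_mono)
      have "(real T / real L) ^ L * p ^ L \<le> real (T choose L) * p ^ L"
        using binomial_ge_n_over_k_pow_k[OF LT, where 'a = real] p0 by (intro mult_right_mono) auto
      then show "(real T / real L * p) ^ L \<le> real (T choose L) * p ^ L" by (simp only: power_mult_distrib)
      show "(1 - p) ^ T \<le> (1 - p) ^ (T - L)" using p0 p1 by (intro power_decreasing) auto
    qed (use p0 p1 in auto)
    also have "\<dots> \<le> code_exp q (s + a) T (\<lambda>ds. of_bool (dec_chains 0 L ds > 0))"
      using p0 p1 p_le q a R_def by (intro code_exp_chain_ge_binomial[where g = g and R = R]) auto
    also have "\<dots> \<le> code_exp q s m (\<lambda>ds. of_bool (dec_chains 0 L ds > 0))"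
      unfolding a using q by (intro code_exp_drop_chain_le) auto
    finally show "?b \<le> code_exp q s m (\<lambda>ds. of_bool (dec_chains 0 L ds > 0))" .
  qed
  then show ?thesis .
qed

section \<open>Permutations without long decreasing subsequences\<close>

text \<open>The Erdos-Szekeres label of a position: the length of a longest decreasing subsequence
  ending there.\<close>

definition dec_rank :: "nat \<Rightarrow> (nat \<Rightarrow> nat) \<Rightarrow> nat \<Rightarrow> nat" where
  "dec_rank n p i = Max (card ` {S. decr_set n p S \<and> S \<subseteq> {..i} \<and> i \<in> S})"

lemma finite_decr_sets: "finite {S. decr_set n p S}"
  by (rule finite_subset[of _ "Pow {1..n}"]) (auto simp: decr_set_def)

lemma dec_rank_in:
  assumes "i \<in> {1..n}"
  obtains S where "decr_set n p S" "S \<subseteq> {..i}" "i \<in> S" "dec_rank n p i = card S"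
proof -
  let ?A = "{S. decr_set n p S \<and> S \<subseteq> {..i} \<and> i \<in> S}"
  have "{i} \<in> ?A" using assms by (auto simp: decr_set_def)
  moreover have "finite ?A" by (rule finite_subset[OF _ finite_decr_sets[of n p]]) auto
  ultimately have "dec_rank n p i \<in> card ` ?A" unfolding dec_rank_def by (intro Max_in) auto
  then show thesis using that by auto
qed

lemma dec_rank_ge:
  assumes "decr_set n p S" "S \<subseteq> {..i}" "i \<in> S"
  shows "card S \<le> dec_rank n p i"
proof -
  have "finite {S. decr_set n p S \<and> S \<subseteq> {..i} \<and> i \<in> S}"
    by (rule finite_subset[OF _ finite_decr_sets[of n p]]) auto
  then show ?thesis unfolding dec_rank_def using assms by (intro Max_ge) auto
qed

lemma dec_rank_le_LDS: "i \<in> {1..n} \<Longrightarrow> dec_rank n p i \<le> LDS n p"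
  by (erule dec_rank_in[of i n p]) (auto simp: le_LDS_iff)

text \<open>Append \<open>j\<close> to an optimal subsequence ending at \<open>i\<close>.
  Contrapositively, the permutation increases on each class of equal rank.\<close>

lemma dec_rank_less:
  assumes "i \<in> {1..n}" "j \<in> {1..n}" "i < j" "p i > p j"
  shows "dec_rank n p i < dec_rank n p j"
proof -
  obtain S where S: "decr_set n p S" "S \<subseteq> {..i}" "i \<in> S" "dec_rank n p i = card S"
    using dec_rank_in[OF assms(1)] .
  have fin: "finite S" "j \<notin> S" using S(2) assms(3) finite_subset by auto
  have below: "p j < p k \<and> k < j" if "k \<in> S" for k
  proof (cases "k = i")
    case False
    then have "k < i" using S(2) that by fastforce
    then have "p i < p k" using S(1,3) that unfolding decr_set_def by blast
    then show ?thesis using assms \<open>k < i\<close> by simp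
  qed (use assms in simp)
  have "decr_set n p (insert j S)"
    unfolding decr_set_def
  proof (intro conjI ballI impI)
    show "insert j S \<subseteq> {1..n}" using S(1) assms(2) unfolding decr_set_def by blast
    fix k l assume "k \<in> insert j S" "l \<in> insert j S" "k < l"
    then show "p l < p k" using below S(1) unfolding decr_set_def by (metis insert_iff less_asym)
  qed
  moreover have "insert j S \<subseteq> {..j}" using below by (auto intro: less_imp_le)
  ultimately have "card (insert j S) \<le> dec_rank n p j" by (intro dec_rank_ge) auto
  then show ?thesis using fin S(4) by simp
qed

text \<open>The ranks of positions and of values determine the permutation: each rank class
  is increasing, so it is matched in order.\<close>

lemma permutes_eq_by_dec_rank:
  assumes p: "p permutes {1..n}" and p': "p' permutes {1..n}"
    and pos: "\<And>i. i \<in> {1..n} \<Longrightarrow> dec_rank n p i = dec_rank n p' i"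
    and val: "\<And>v. v \<in> {1..n} \<Longrightarrow> dec_rank n p (inv p v) = dec_rank n p' (inv p' v)"
  shows "p = p'"
proof
  \<comment> \<open>At a first disagreement \<open>i\<close>, let p' take the value p i at
    \<open>j\<close>. Then \<open>i\<close> and \<open>j\<close> share their rank under p', so j
    cannot come after i. Before i the two permutations agree, which contradicts injectivity. The
    lemma is local so that p and p' can be exchanged.\<close>
  have not_less: "\<not> p i < p' i"
    if p: "p permutes {1..n}" and p': "p' permutes {1..n}"
    and pos: "\<And>i. i \<in> {1..n} \<Longrightarrow> dec_rank n p i = dec_rank n p' i"
    and val: "\<And>v. v \<in> {1..n} \<Longrightarrow> dec_rank n p (inv p v) = dec_rank n p' (inv p' v)"
    and i: "i \<in> {1..n}" and IH: "\<And>j. j < i \<Longrightarrow> p j = p' j" for p p' i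
  proof
    assume less: "p i < p' i"
    define j where "j = inv p' (p i)"
    have pi: "p i \<in> {1..n}" using i permutes_in_image[OF p] by blast
    then have j: "j \<in> {1..n}" unfolding j_def using permutes_in_image[OF permutes_inv[OF p']] by blast
    have pj: "p' j = p i" unfolding j_def using permutes_inverses(1)[OF p'] by simp
    have "dec_rank n p' j = dec_rank n p' i"
      using val[OF pi] pos[OF i] permutes_inverses(2)[OF p] by (simp add: j_def)
    then have "\<not> i < j" using dec_rank_less[of i n j p'] i j less pj by auto
    moreover have "i \<noteq> j" using less pj by auto
    ultimately have "p j = p' j" using IH by simp
    then have "j = i" using pj permutes_inj[OF p] by (metis injD)
    then show False using \<open>i \<noteq> j\<close> by simp
  qed
  fix i show "p i = p' i"
  proof (induction i rule: less_induct)
    case (less i)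
    show ?case
    proof (cases "i \<in> {1..n}")
      case True
      have "\<not> p i < p' i" by (rule not_less[OF p p' pos val True less])
      moreover have "\<not> p' i < p i"
        by (rule not_less[OF p' p pos[symmetric] val[symmetric] True less[symmetric]])
      ultimately show ?thesis by simp
    next
      case False
      then show ?thesis using p p' by (simp add: permutes_not_in)
    qed
  qed
qed

lemma card_perms_LDS_less: "card {p \<in> perms n. LDS n p < L} \<le> L ^ (2 * n)"
proof -
  let ?A = "{p \<in> perms n. LDS n p < L}" and ?F = "{1..n} \<rightarrow>\<^sub>E {..<L}"
  define f where "f p = (restrict (dec_rank n p) {1..n}, restrict (dec_rank n p \<circ> inv p) {1..n})" for p
  have "inj_on f ?A"
  proof (rule inj_onI)
    fix p p' assume "p \<in> ?A" "p' \<in> ?A" and eq: "f p = f p'"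
    then have perm: "p permutes {1..n}" "p' permutes {1..n}" by (auto simp: perms_def)
    have "restrict (dec_rank n p) {1..n} = restrict (dec_rank n p') {1..n}"
      and "restrict (dec_rank n p \<circ> inv p) {1..n} = restrict (dec_rank n p' \<circ> inv p') {1..n}"
      using eq unfolding f_def by (simp_all only: prod.inject)
    note eq = fun_cong[OF this(1)] fun_cong[OF this(2)]
    have "dec_rank n p i = dec_rank n p' i" if "i \<in> {1..n}" for i
      using eq(1)[of i] that by (simp only: restrict_apply')
    moreover have "dec_rank n p (inv p v) = dec_rank n p' (inv p' v)" if "v \<in> {1..n}" for v
      using eq(2)[of v] that by (simp only: restrict_apply' comp_apply)
    ultimately show "p = p'" by (rule permutes_eq_by_dec_rank[OF perm])
  qed
  moreover have "f ` ?A \<subseteq> ?F \<times> ?F"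
  proof (rule image_subsetI)
    fix p assume p: "p \<in> ?A"
    then have perm: "p permutes {1..n}" by (simp add: perms_def)
    have "dec_rank n p i < L" if "i \<in> {1..n}" for i
      using dec_rank_le_LDS[OF that, of p] p by simp
    moreover have "inv p v \<in> {1..n}" if "v \<in> {1..n}" for v
      using that permutes_in_image[OF permutes_inv[OF perm]] by blast
    ultimately show "f p \<in> ?F \<times> ?F" unfolding f_def by (auto simp: PiE_iff)
  qed
  moreover have "finite (?F \<times> ?F)" by (intro finite_cartesian_product finite_PiE) auto
  ultimately have "card ?A \<le> card (?F \<times> ?F)" by (rule card_inj_on_le)
  also have "\<dots> = L ^ (2 * n)" by (simp add: card_cartesian_product card_PiE power_add mult_2)
  finally show ?thesis .
qed

section \<open>The partition function and the bound for small values\<close>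

text \<open>Write Z as the product of (1-q^i)/(1-q). The numerators lose a factor 2 each and one
  exponential, which the assumption on \<open>n\<close> absorbs into 3^n.\<close>

lemma mallows_Z_ge:
  assumes q: "0 < q" "q < 1" and n: "1 / (1 - q) + 1 \<le> real n"
  shows "1 / (6 * (1 - q)) ^ n \<le> mallows_Z n q"
proof -
  have "1 / (6 * (1 - q)) ^ n = (1 / 3) ^ n / 2 ^ n / (1 - q) ^ n"
    by (simp only: power_mult_distrib power_divide power_one divide_divide_eq_left)
      (simp flip: power_mult_distrib)
  also have "\<dots> \<le> exp (- (1 / (1 - q) + 1)) / 2 ^ n / (1 - q) ^ n"
  proof (intro divide_right_mono)
    have "(1 / 3 :: real) ^ n \<le> exp (- real n)"
      using exp_nat_le[of 1 n] by (simp add: power_divide exp_minus field_simps)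
    also have "\<dots> \<le> exp (- (1 / (1 - q) + 1))" using n by simp
    finally show "(1 / 3 :: real) ^ n \<le> exp (- (1 / (1 - q) + 1))" .
  qed (use q in auto)
  also have "\<dots> \<le> (\<Prod>i<n. 1 - q ^ Suc i) / (1 - q) ^ n"
    using q by (intro divide_right_mono prod_one_minus_power_ge) auto
  also have "\<dots> = (\<Prod>i<n. (1 - q ^ Suc i) / (1 - q))" by (simp add: prod_dividef)
  also have "\<dots> = mallows_Z n q"
    unfolding mallows_Z_eq[OF q(1)] geom_sum_mult[symmetric] lessThan_Suc_atMost using q by simp
  finally show ?thesis .
qed

lemma mallows_prob_LDS_less_le:
  assumes q: "0 < q" "q < 1" and n: "1 / (1 - q) + 1 \<le> real n"
  shows "mallows_prob n q (\<lambda>p. LDS n p < L) \<le> (6 * (1 - q) * real L ^ 2) ^ n"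
proof -
  let ?A = "{p \<in> perms n. LDS n p < L}"
  have x: "0 < (6 * (1 - q)) ^ n" using q by simp
  have "(\<Sum>p\<in>?A. q ^ inv_count n p) \<le> (\<Sum>p\<in>?A. 1)"
    using q by (intro sum_mono) (simp add: power_le_one)
  also have "\<dots> \<le> real (L ^ (2 * n))" using card_perms_LDS_less[of n L] by simp
  finally have "(\<Sum>p\<in>?A. q ^ inv_count n p) \<le> real L ^ (2 * n)" by simp
  then have "mallows_prob n q (\<lambda>p. LDS n p < L) \<le> real L ^ (2 * n) / (1 / (6 * (1 - q)) ^ n)"
    unfolding mallows_prob_def using mallows_Z_ge[OF q n] x by (intro frac_le) auto
  also have "\<dots> = (6 * (1 - q) * real L ^ 2) ^ n"
    by (simp only: power_mult_distrib power_mult divide_divide_eq_right div_by_1) simp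
  finally show ?thesis .
qed

lemma no_long_decreasing:
  assumes q: "1 / 2 \<le> q" "q \<le> 1 - 4 / real n" "q < 1" and n: "n \<ge> 2"
    and L: "2 \<le> L" "real L < c / sqrt (1 - q)" and c: "6 * c\<^sup>2 \<le> 1" and C: "6 \<le> C"
  shows "mallows_prob n q (\<lambda>p. LDS n p < L) \<le> (C * (1 - q) * real L ^ 2) powr (real n / real L)"
proof -
  have "4 \<le> real n * (1 - q)" using q n by (simp add: field_simps)
  moreover have "real n * (1 - q) \<le> real n * (1 / 2)" using q by (intro mult_left_mono) auto
  ultimately have "8 \<le> real n" "1 / (1 - q) \<le> real n / 4" using q by (auto simp: field_simps)
  then have n': "1 / (1 - q) + 1 \<le> real n" by simp
  let ?y = "6 * (1 - q) * real L ^ 2"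
  have y0: "0 < ?y" using q L by simp
  have "real L * sqrt (1 - q) < c" using L q by (simp add: field_simps)
  then have "(real L * sqrt (1 - q))\<^sup>2 \<le> c\<^sup>2" using q by (intro power_mono) auto
  then have "(1 - q) * real L ^ 2 \<le> c\<^sup>2" using q by (simp add: power_mult_distrib mult.commute)
  then have "6 * ((1 - q) * real L ^ 2) \<le> 1" using c by linarith
  then have y1: "?y \<le> 1" by (simp only: mult.assoc)
  have "mallows_prob n q (\<lambda>p. LDS n p < L) \<le> ?y ^ n"
    using q n' by (intro mallows_prob_LDS_less_le) auto
  also have "\<dots> = ?y powr real n" using y0 by (simp add: powr_realpow)
  \<comment> \<open>The bound with exponent n is stronger: the base is at most 1 by the choice of
    \<open>c\<close>, so the exponent may be lowered.\<close>
  also have "\<dots> \<le> ?y powr (real n / real L)"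
  proof (rule powr_mono')
    have "real n / real L \<le> real n / 1" using L by (intro divide_left_mono) auto
    then show "real n / real L \<le> real n" by simp
  qed (use y0 y1 in auto)
  also have "\<dots> \<le> (C * (1 - q) * real L ^ 2) powr (real n / real L)"
    using y0 C q by (intro powr_mono2 mult_right_mono) auto
  finally show ?thesis .
qed

theorem theorem1p7:
  shows "\<exists>C c :: real. C > 0 \<and> c > 0 \<and>
    (\<forall>(n::nat) (q::real). n \<ge> 2 \<and> 0 < q \<and> q < 1 \<longrightarrow>
      \<comment> \<open>(i), first part\<close>
      ((q < 1 - 2 / real n \<longrightarrow>
         (\<forall>L::nat. L \<ge> 2 \<longrightarrow>
            mallows_prob n q (\<lambda>p. LDS n p \<ge> L) \<le> real n ^ 8 *
              (if real L \<le> 3 / (1 - q)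
               then (C / ((1 - q) * real L ^ 2)) ^ L
               else (C * (1 - q)) ^ L * q ^ (L * (L - 1) div 2)))) \<and>
      \<comment> \<open>(i), second part\<close>
       (q < 1/2 \<longrightarrow>
         (\<forall>L::nat. L \<ge> 2 \<longrightarrow>
            mallows_prob n q (\<lambda>p. LDS n p \<ge> L) \<le> real n * C ^ L * q ^ (L * (L - 1) div 2))) \<and>
      \<comment> \<open>(ii), first part\<close>
       (\<forall>L::nat. C / sqrt (1 - q) \<le> real L \<and> real L \<le> 1 / (1 - q) \<and>
                 1/2 \<le> q \<and> q \<le> 1 - 4 / real n \<longrightarrow>
            mallows_prob n q (\<lambda>p. LDS n p \<ge> L) \<ge>
              1 - (1 - (c / ((1 - q) * real L ^ 2)) ^ L) ^ nat \<lfloor>real n * (1 - q) / 4\<rfloor>) \<and>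
      \<comment> \<open>(ii), second part\<close>
       (\<forall>L::nat. L \<ge> 2 \<longrightarrow>
            mallows_prob n q (\<lambda>p. LDS n p \<ge> L) \<ge>
              1 - (1 - q ^ (L * (L - 1) div 2) * (1 - q) ^ L) ^ (n div L)) \<and>
      \<comment> \<open>(iii)\<close>
       (1/2 \<le> q \<and> q \<le> 1 - 4 / real n \<longrightarrow>
         (\<forall>L::nat. 2 \<le> L \<and> real L < c / sqrt (1 - q) \<longrightarrow>
            mallows_prob n q (\<lambda>p. LDS n p < L) \<le>
              (C * (1 - q) * real L ^ 2) powr (real n / real L)))))"
proof (intro exI conjI allI impI)
  \<comment> \<open>C = 3^5 comes from exp(5L) <= (3^5)^L and exceeds the other constants 216, 8, 6
    and 1. c = 1/972 comes from the greedy bound and also satisfies 6c^2 <= 1.\<close>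
  show "0 < (3 ^ 5 :: real)" "0 < (1 / 972 :: real)" by simp_all
next
  fix n :: nat and q :: real and L :: nat
  assume "n \<ge> 2 \<and> 0 < q \<and> q < 1" "q < 1 - 2 / real n" "L \<ge> 2"
  then show "mallows_prob n q (\<lambda>p. LDS n p \<ge> L) \<le> real n ^ 8 *
      (if real L \<le> 3 / (1 - q) then (3 ^ 5 / ((1 - q) * real L ^ 2)) ^ L
       else (3 ^ 5 * (1 - q)) ^ L * q ^ (L * (L - 1) div 2))"
    using upper_tail_small[of q n L "3 ^ 5"] upper_tail_large[of q n L "3 ^ 5"]
    by (simp only: not_le split: if_split) auto
next
  fix n :: nat and q :: real and L :: nat
  assume "n \<ge> 2 \<and> 0 < q \<and> q < 1" "q < 1 / 2" "L \<ge> 2"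
  then show "mallows_prob n q (\<lambda>p. LDS n p \<ge> L) \<le> real n * (3 ^ 5) ^ L * q ^ (L * (L - 1) div 2)"
    by (intro upper_tail_half) auto
next
  fix n :: nat and q :: real and L :: nat
  assume *: "n \<ge> 2 \<and> 0 < q \<and> q < 1"
    and "3 ^ 5 / sqrt (1 - q) \<le> real L \<and> real L \<le> 1 / (1 - q) \<and> 1 / 2 \<le> q \<and> q \<le> 1 - 4 / real n"
  moreover have "1 / sqrt (1 - q) \<le> 3 ^ 5 / sqrt (1 - q)"
    using * by (intro divide_right_mono) auto
  ultimately show "mallows_prob n q (\<lambda>p. LDS n p \<ge> L) \<ge>
      1 - (1 - (1 / 972 / ((1 - q) * real L ^ 2)) ^ L) ^ nat \<lfloor>real n * (1 - q) / 4\<rfloor>"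
    by (intro lower_tail_moderate) auto
next
  fix n :: nat and q :: real and L :: nat
  assume "n \<ge> 2 \<and> 0 < q \<and> q < 1"
  then show "mallows_prob n q (\<lambda>p. LDS n p \<ge> L) \<ge>
      1 - (1 - q ^ (L * (L - 1) div 2) * (1 - q) ^ L) ^ (n div L)"
    by (intro lower_tail_consecutive) auto
next
  fix n :: nat and q :: real and L :: nat
  assume "n \<ge> 2 \<and> 0 < q \<and> q < 1" "1 / 2 \<le> q \<and> q \<le> 1 - 4 / real n"
    "2 \<le> L \<and> real L < 1 / 972 / sqrt (1 - q)"
  then show "mallows_prob n q (\<lambda>p. LDS n p < L) \<le> (3 ^ 5 * (1 - q) * real L ^ 2) powr (real n / real L)"
    by (intro no_long_decreasing[where c = "1 / 972"]) (auto simp: power2_eq_square)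
qed

end
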